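(* Let $G$ be a countable amenable group, let $(X,\mu,G,\varphi)$ be a multiordered dynamical system, i.e. a measure-preserving action $(X,\mu,G)$ on a standard probability space together with a fixed measure-theoretic factor map $\varphi:(X,\mu,G)\to(\tilde{\mathcal O},\nu,G)$ to a multiorder, and let $\mathcal P$ be a finite measurable partition of $X$. Let $\{\mu_{\prec}:\prec\,\in\tilde{\mathcal O}\}$ denote the disintegration of $\mu$ with respect to $\nu=\varphi(\mu)$, and let $\Sigma_{\tilde{\mathcal O}}$ denote the invariant sub-sigma-algebra on $X$ consisting of the preimages under $\varphi$ of the Borel sets in $\tilde{\mathcal O}$. Then $$h(\mu,G,\mathcal P\,|\,\Sigma_{\tilde{\mathcal O}})=\int H(\mu_{\prec},\mathcal P\,|\,\mathcal P^-_{\prec})\,\mathrm d\nu(\prec)=\int H(\mu_{\prec},\mathcal P\,|\,\mathcal P^+_{\prec})\,\mathrm d\nu(\prec).$$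
   Context: A countable amenable group means an infinite countable discrete group $G$ (unit $e$) in which there is a Følner sequence, i.e. a sequence of finite subsets $F_n\subset G$ with $\lim_n |F_n\cap gF_n|/|F_n|=1$ for every $g\in G$. A linear order $\prec$ on $G$ is of type $\mathbb Z$ if every order interval $[a,b]^{\prec}=\{a,b\}\cup\{g\in G: a\prec g\prec b\}$ ($a\prec b$) is finite and $G$ has no minimal or maximal element. The set $\tilde{\mathcal O}$ of all orders of type $\mathbb Z$ on $G$ is a Borel subset of $\{0,1\}^{G\times G}$ (relations identified with their indicator functions, product topology), with the inherited Borel sigma-algebra. $G$ acts on $\tilde{\mathcal O}$ by: $\prec'=g(\prec)$ where $a\prec' b\iff ag\prec bg$. A multiorder on $G$ is the measure-preserving action $(\tilde{\mathcal O},\nu,G)$, where $\nu$ is a $G$-invariant Borel probability measure on $\tilde{\mathcal O}$. For $\prec\,\in\tilde{\mathcal O}$, $i\mapsto i^{\prec}$ denotes the unique bijection $\mathbb Z\to G$ such that $0^{\prec}=e$ and $(i+1)^{\prec}$ is the successor of $i^{\prec}$ for all $i$. For $D\subset G$, $\mathcal P^D=\bigvee_{g\in D}g^{-1}(\mathcal P)$ (a sigma-algebra if $D$ is infinite). The past and the future of $\mathcal P$ with respect to $\prec$ are $\mathcal P^-_{\prec}=\mathcal P^{\{i^{\prec}:\,i\le -1\}}$ and $\mathcal P^+_{\prec}=\mathcal P^{\{i^{\prec}:\,i\ge 1\}}$. Entropy: $H(\mu,\mathcal P)=-\sum_{P\in\mathcal P}\mu(P)\log\mu(P)$; for a sub-sigma-algebra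 $\Theta$, $H(\mu,\mathcal P|\Theta)=\inf_{\mathcal Q}\bigl(H(\mu,\mathcal P\vee\mathcal Q)-H(\mu,\mathcal Q)\bigr)$ over finite $\Theta$-measurable partitions $\mathcal Q$; for $G$-invariant $\Theta$, $h(\mu,G,\mathcal P|\Theta)=\lim_n\frac1{|F_n|}H(\mu,\mathcal P^{F_n}|\Theta)$ for any Følner sequence $(F_n)$. *)

theory Defs
  imports "HOL-Probability.Probability" "HOL-Algebra.Group_Action"
begin

definition borel_of :: "'a topology \<Rightarrow> 'a measure" where
  "borel_of X = sigma (topspace X) {U. openin X U}"

text \<open>Standard probability spaces are read as probability measures on the Borel
  sigma-algebra of a Polish space (not completed).\<close>

definition standard_borel :: "'a measure \<Rightarrow> bool" where
  "standard_borel M \<longleftrightarrow>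
     (\<exists>X. completely_metrizable_space X \<and> second_countable X \<and>
          space M = topspace X \<and> sets M = sets (borel_of X))"

definition standard_prob_space :: "'a measure \<Rightarrow> bool" where
  "standard_prob_space M \<longleftrightarrow> prob_space M \<and> standard_borel M"

text \<open>Since \<open>x / 0 = 0\<close>, the limit condition forces \<open>F n\<close> to be nonempty for all large \<open>n\<close>.\<close>

definition folner_seq :: "('g, 'm) monoid_scheme \<Rightarrow> (nat \<Rightarrow> 'g set) \<Rightarrow> bool" where
  "folner_seq G F \<longleftrightarrow>
     (\<forall>n. finite (F n) \<and> F n \<subseteq> carrier G) \<and>
     (\<forall>g\<in>carrier G.
        (\<lambda>n. real (card (F n \<inter> (g <#\<^bsub>G\<^esub> F n))) / real (card (F n))) \<longlonglongrightarrow> 1)"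

definition countable_amenable_group :: "('g, 'm) monoid_scheme \<Rightarrow> bool" where
  "countable_amenable_group G \<longleftrightarrow>
     group G \<and> countable (carrier G) \<and> infinite (carrier G) \<and> (\<exists>F. folner_seq G F)"

definition mp_action ::
  "('g, 'm) monoid_scheme \<Rightarrow> 'a measure \<Rightarrow> ('g \<Rightarrow> 'a \<Rightarrow> 'a) \<Rightarrow> bool" where
  "mp_action G M T \<longleftrightarrow>
     prob_space M \<and> group_action G (space M) T \<and>
     (\<forall>g\<in>carrier G. T g \<in> M \<rightarrow>\<^sub>M M \<and> distr M M (T g) = M)"

definition factor_map ::
  "('g, 'm) monoid_scheme \<Rightarrow> 'a measure \<Rightarrow> ('g \<Rightarrow> 'a \<Rightarrow> 'a) \<Rightarrow>
   'b measure \<Rightarrow> ('g \<Rightarrow> 'b \<Rightarrow> 'b) \<Rightarrow> ('a \<Rightarrow> 'b) \<Rightarrow> bool" where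
  "factor_map G M T N S \<phi> \<longleftrightarrow>
     \<phi> \<in> M \<rightarrow>\<^sub>M N \<and> distr M N \<phi> = N \<and>
     (\<forall>g\<in>carrier G. AE x in M. \<phi> (T g x) = S g (\<phi> x))"

definition pullback_sigma :: "'a measure \<Rightarrow> 'b measure \<Rightarrow> ('a \<Rightarrow> 'b) \<Rightarrow> 'a set set" where
  "pullback_sigma M N \<phi> = {\<phi> -` B \<inter> space M |B. B \<in> sets N}"

definition disintegration ::
  "'a measure \<Rightarrow> 'b measure \<Rightarrow> ('a \<Rightarrow> 'b) \<Rightarrow> ('b \<Rightarrow> 'a measure) \<Rightarrow> bool" where
  "disintegration M N \<phi> \<kappa> \<longleftrightarrow>
     \<kappa> \<in> N \<rightarrow>\<^sub>M prob_algebra M \<and>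
     (\<forall>A\<in>sets M. emeasure M A = (\<integral>\<^sup>+y. emeasure (\<kappa> y) A \<partial>N)) \<and>
     (AE y in N. AE x in \<kappa> y. \<phi> x = y)"

text \<open>An order is represented by its strict relation: \<open>(a, b) \<in> r\<close> means that \<open>a\<close> strictly
  precedes \<open>b\<close>.\<close>

definition order_interval :: "('g, 'm) monoid_scheme \<Rightarrow> 'g rel \<Rightarrow> 'g \<Rightarrow> 'g \<Rightarrow> 'g set" where
  "order_interval G r a b = {a, b} \<union> {g \<in> carrier G. (a, g) \<in> r \<and> (g, b) \<in> r}"

definition Z_orders :: "('g, 'm) monoid_scheme \<Rightarrow> 'g rel set" where
  "Z_orders G = {r. r \<subseteq> carrier G \<times> carrier G \<and> strict_linear_order_on (carrier G) r \<and>
     (\<forall>a b. (a, b) \<in> r \<longrightarrow> finite (order_interval G r a b)) \<and>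
     (\<forall>a\<in>carrier G. (\<exists>b\<in>carrier G. (b, a) \<in> r) \<and> (\<exists>b\<in>carrier G. (a, b) \<in> r))}"

text \<open>The topology that \<open>Z_orders G\<close> inherits from the product space of all \<open>{0,1}\<close>-valued
  functions on \<open>G \<times> G\<close>, via indicator functions of relations.\<close>

definition Z_orders_topology :: "('g, 'm) monoid_scheme \<Rightarrow> 'g rel topology" where
  "Z_orders_topology G =
     pullback_topology (Z_orders G) (\<lambda>r. \<lambda>p\<in>carrier G \<times> carrier G. p \<in> r)
       (product_topology (\<lambda>_. discrete_topology (UNIV :: bool set)) (carrier G \<times> carrier G))"

definition order_action :: "('g, 'm) monoid_scheme \<Rightarrow> 'g \<Rightarrow> 'g rel \<Rightarrow> 'g rel" where
  "order_action G g = (\<lambda>r\<in>Z_orders G.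
     {(a, b). a \<in> carrier G \<and> b \<in> carrier G \<and> (a \<otimes>\<^bsub>G\<^esub> g, b \<otimes>\<^bsub>G\<^esub> g) \<in> r})"

definition multiorder :: "('g, 'm) monoid_scheme \<Rightarrow> 'g rel measure \<Rightarrow> bool" where
  "multiorder G \<nu> \<longleftrightarrow>
     sets \<nu> = sets (borel_of (Z_orders_topology G)) \<and> mp_action G \<nu> (order_action G)"

definition is_successor :: "('g, 'm) monoid_scheme \<Rightarrow> 'g rel \<Rightarrow> 'g \<Rightarrow> 'g \<Rightarrow> bool" where
  "is_successor G r a b \<longleftrightarrow>
     (a, b) \<in> r \<and> (\<forall>c\<in>carrier G. \<not> ((a, c) \<in> r \<and> (c, b) \<in> r))"

definition order_enum :: "('g, 'm) monoid_scheme \<Rightarrow> 'g rel \<Rightarrow> int \<Rightarrow> 'g" where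
  "order_enum G r = (THE f. bij_betw f UNIV (carrier G) \<and> f 0 = \<one>\<^bsub>G\<^esub> \<and>
     (\<forall>i. is_successor G r (f i) (f (i + 1))))"

definition measurable_partition :: "'a measure \<Rightarrow> 'a set set \<Rightarrow> 'a set set \<Rightarrow> bool" where
  "measurable_partition M \<Theta> P \<longleftrightarrow> finite P \<and> partition_on (space M) P \<and> P \<subseteq> \<Theta>"

definition translate_partition ::
  "'a measure \<Rightarrow> ('g \<Rightarrow> 'a \<Rightarrow> 'a) \<Rightarrow> 'a set set \<Rightarrow> 'g \<Rightarrow> 'a set set" where
  "translate_partition M T P g = (\<lambda>A. T g -` A \<inter> space M) ` P"

text \<open>The join over \<open>D\<close> of the preimages of \<open>P\<close> is used as a partition for finite nonempty \<open>D\<close>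
  and as a sigma-algebra for infinite \<open>D\<close>.\<close>

definition join_partition ::
  "'a measure \<Rightarrow> ('g \<Rightarrow> 'a \<Rightarrow> 'a) \<Rightarrow> 'a set set \<Rightarrow> 'g set \<Rightarrow> 'a set set" where
  "join_partition M T P D = common_refinement (translate_partition M T P ` D)"

definition join_sigma ::
  "'a measure \<Rightarrow> ('g \<Rightarrow> 'a \<Rightarrow> 'a) \<Rightarrow> 'a set set \<Rightarrow> 'g set \<Rightarrow> 'a set set" where
  "join_sigma M T P D = sigma_sets (space M) (\<Union>g\<in>D. translate_partition M T P g)"

definition past_sigma ::
  "('g, 'm) monoid_scheme \<Rightarrow> 'a measure \<Rightarrow> ('g \<Rightarrow> 'a \<Rightarrow> 'a) \<Rightarrow> 'a set set \<Rightarrow> 'g rel \<Rightarrow> 'a set set"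
  where "past_sigma G M T P r = join_sigma M T P (order_enum G r ` {i. i \<le> -1})"

definition future_sigma ::
  "('g, 'm) monoid_scheme \<Rightarrow> 'a measure \<Rightarrow> ('g \<Rightarrow> 'a \<Rightarrow> 'a) \<Rightarrow> 'a set set \<Rightarrow> 'g rel \<Rightarrow> 'a set set"
  where "future_sigma G M T P r = join_sigma M T P (order_enum G r ` {i. i \<ge> 1})"

text \<open>Natural logarithms; \<open>0 * ln 0 = 0\<close> holds in HOL.\<close>

definition part_entropy :: "'a measure \<Rightarrow> 'a set set \<Rightarrow> real" where
  "part_entropy M P = - (\<Sum>A\<in>P. measure M A * ln (measure M A))"

definition cond_part_entropy :: "'a measure \<Rightarrow> 'a set set \<Rightarrow> 'a set set \<Rightarrow> real" where
  "cond_part_entropy M P \<Theta> =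
     (INF Q\<in>{Q. measurable_partition M \<Theta> Q}.
        part_entropy M (common_refinement {P, Q}) - part_entropy M Q)"

text \<open>The value is the common limit along all Folner sequences.\<close>

definition cond_dyn_entropy ::
  "('g, 'm) monoid_scheme \<Rightarrow> 'a measure \<Rightarrow> ('g \<Rightarrow> 'a \<Rightarrow> 'a) \<Rightarrow> 'a set set \<Rightarrow> 'a set set \<Rightarrow> real"
  where
  "cond_dyn_entropy G M T P \<Theta> = (THE h. \<forall>F. folner_seq G F \<longrightarrow>
     (\<lambda>n. cond_part_entropy M (join_partition M T P (F n)) \<Theta> / real (card (F n))) \<longlonglongrightarrow> h)"

end

theory Submission
  imports Defs
begin

text \<open>Enumerate a finite set \<open>F\<close> increasingly along the random order and apply the chain rule for
  entropy: \<open>H(\<mu>\<^sub>r, P\<^sup>F)\<close> is the sum over \<open>g \<in> F\<close> of the entropies of \<open>g\<^sup>-\<^sup>1 P\<close> given the translates of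
  \<open>P\<close> by the elements of \<open>F\<close> that precede \<open>g\<close>. By equivariance of the disintegration and invariance of
  \<open>\<nu>\<close>, the summand for \<open>g\<close> has the same \<open>\<nu>\<close>-integral as the entropy of \<open>P\<close> given the join over those
  elements of \<open>F g\<^sup>-\<^sup>1\<close> that lie in the past of the unit. This is at least the entropy given the whole
  past, and at most the entropy given the past inside a fixed finite set \<open>K\<close> as soon as
  \<open>K g \<subseteq> F\<close>, which the Folner property guarantees for most \<open>g \<in> F\<close>. Letting \<open>K\<close> exhaust the group
  closes the gap. The integral of \<open>H(\<mu>\<^sub>r, P\<^sup>F)\<close> is identified with \<open>H(\<mu>, P\<^sup>F | \<Sigma>)\<close> by discretising the
  conditional probabilities, using that \<open>-t ln t\<close> is uniformly continuous on \<open>[0, 1]\<close>.\<close>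

section \<open>Entropy of finite-valued functions\<close>

text \<open>The obstacle is measurability and continuity in the order: \<open>rate y\<close> is an
  infimum over partitions taken from a sigma-algebra that itself varies with \<open>y\<close>.
  Everything is therefore done first for finite conditioning sets, where
  \<open>D \<inter> past y\<close> takes only finitely many values, and \<open>rate\<close> is
  reached as the pointwise limit of \<open>finite_rate\<close> along one exhaustion of the group.
  That limit rests on approximating the sets of a sigma-algebra by those of a generating algebra.
  The translation to the unit uses that \<open>h\<close> precedes \<open>g\<close> in
  \<open>L y\<close> exactly when \<open>h \<otimes> inv g\<close> precedes the unit in
  \<open>L (S g y)\<close>. The fibre measures are equivariant only up to null sets, so this is used
  for finitely many group elements and finitely many sets at a time. Partitions are replaced by
  label functions: entropy depends only on the level sets, a join becomes a pair, and an empty join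
  becomes a constant, which the chain rule meets at the least element of \<open>F\<close>.\<close>

definition eta :: "real \<Rightarrow> real" where
  "eta t = - (t * ln t)"

definition fent :: "'a measure \<Rightarrow> ('a \<Rightarrow> 'b) \<Rightarrow> real" where
  "fent N X = (\<Sum>v\<in>X ` space N. eta (measure N (X -` {v} \<inter> space N)))"

definition fcent :: "'a measure \<Rightarrow> ('a \<Rightarrow> 'b) \<Rightarrow> ('a \<Rightarrow> 'c) \<Rightarrow> real" where
  "fcent N X Y = fent N (\<lambda>x. (X x, Y x)) - fent N Y"

lemma eta_0 [simp]: "eta 0 = 0"
  by (simp add: eta_def)

lemma eta_1 [simp]: "eta 1 = 0"
  by (simp add: eta_def)

lemma eta_nonneg: "0 \<le> t \<Longrightarrow> t \<le> 1 \<Longrightarrow> 0 \<le> eta t"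
  by (cases "t = 0") (auto simp: eta_def mult_nonneg_nonpos)

text \<open>The inequality \<open>ln (1 / t) \<le> 1 / t - 1\<close> even gives
  \<open>1 - t\<close>. A bound independent of the measure is what dominated convergence over the
  fibres will use.\<close>

lemma eta_le_1:
  assumes "0 \<le> t"
  shows "eta t \<le> 1"
proof (cases "t = 0")
  case False
  with assms have "t > 0" by simp
  then have "ln (1 / t) \<le> 1 / t - 1" by (intro ln_le_minus_one) simp
  then have "t * ln (1 / t) \<le> t * (1 / t - 1)" using \<open>t > 0\<close> by (intro mult_left_mono) auto
  then show ?thesis using \<open>t > 0\<close> by (simp add: eta_def ln_div algebra_simps)
qed auto

text \<open>A product rule. For a cell of measure \<open>s\<close> cut in proportions
  \<open>t\<close> it splits the entropy into \<open>s\<close> times the entropy of the proportions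
  and a part that cancels against the entropy of the cell.\<close>

lemma eta_mult:
  assumes "0 \<le> s" "0 \<le> t"
  shows "eta (s * t) = s * eta t + t * eta s"
  using assms by (cases "s = 0 \<or> t = 0") (auto simp: eta_def ln_mult algebra_simps)

lemma continuous_on_eta: "continuous_on {0..} eta"
proof -
  have "continuous (at x within {0..}) eta" if "x \<ge> 0" for x :: real
  proof (cases "x = 0")
    case True
    have "((\<lambda>t::real. t * ln t) \<longlongrightarrow> 0) (at_right 0)"
      by real_asymp
    then have "(eta \<longlongrightarrow> 0) (at_right 0)"
      unfolding eta_def using tendsto_minus by fastforce
    moreover have "at (0::real) within {0..} = at_right 0"
      by (rule at_within_Ici_at_right)
    ultimately show ?thesis using True by (simp add: continuous_within)
  next
    case False
    with that have "isCont (\<lambda>t. - (t * ln t)) x" by (intro continuous_intros) auto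
    then show ?thesis unfolding eta_def by (rule continuous_at_imp_continuous_at_within)
  qed
  then show ?thesis by (simp add: continuous_on_eq_continuous_within)
qed

lemma eta_uniform:
  assumes "e > 0"
  obtains d where "d > 0"
    "\<And>s t. s \<in> {0..1} \<Longrightarrow> t \<in> {0..1} \<Longrightarrow> \<bar>s - t\<bar> < d \<Longrightarrow> \<bar>eta s - eta t\<bar> < e"
proof -
  have "uniformly_continuous_on {0..1} eta"
    by (intro compact_uniformly_continuous continuous_on_subset[OF continuous_on_eta]) auto
  then obtain d where "d > 0"
    "\<forall>t\<in>{0..1}. \<forall>s\<in>{0..1}. dist s t < d \<longrightarrow> dist (eta s) (eta t) < e"
    using assms unfolding uniformly_continuous_on_def by blast
  then show ?thesis using that by (auto simp: dist_real_def)
qed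

text \<open>Values that are not attained contribute \<open>eta 0 = 0\<close>, so functions with
  different ranges can be compared over one index set.\<close>

lemma fent_superset:
  assumes "finite V" "X ` space N \<subseteq> V"
  shows "fent N X = (\<Sum>v\<in>V. eta (measure N (X -` {v} \<inter> space N)))"
  unfolding fent_def
proof (rule sum.mono_neutral_left)
  show "\<forall>v\<in>V - X ` space N. eta (measure N (X -` {v} \<inter> space N)) = 0"
  proof
    fix v assume "v \<in> V - X ` space N"
    then have "X -` {v} \<inter> space N = {}" by auto
    then show "eta (measure N (X -` {v} \<inter> space N)) = 0" by simp
  qed
qed (use assms in auto)

text \<open>Entropy sees only the partition into level sets: \<open>Y\<close> is an injective
  relabelling \<open>h\<close> of \<open>X\<close>. This lets differently coded labels be exchanged
  freely.\<close>

lemma fent_kernel: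
  assumes "\<And>x y. x \<in> space N \<Longrightarrow> y \<in> space N \<Longrightarrow> X x = X y \<longleftrightarrow> Y x = Y y"
  shows "fent N X = fent N Y"
proof -
  define h where "h = (\<lambda>v. Y (inv_into (space N) X v))"
  have h: "h (X x) = Y x" if "x \<in> space N" for x
    using assms[of "inv_into (space N) X (X x)" x] that
    by (simp add: h_def f_inv_into_f inv_into_into)
  have inj: "inj_on h (X ` space N)"
    by (rule inj_onI) (auto simp: h assms)
  have "Y ` space N = h ` (X ` space N)"
    by (simp add: image_image h)
  then have "fent N Y = (\<Sum>v\<in>X ` space N. eta (measure N (Y -` {h v} \<inter> space N)))"
    unfolding fent_def by (simp add: sum.reindex[OF inj])
  also have "\<dots> = fent N X"
    unfolding fent_def
  proof (rule sum.cong[OF refl])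
    fix v assume "v \<in> X ` space N"
    then have "Y -` {h v} \<inter> space N = X -` {v} \<inter> space N"
      by (auto simp: h assms)
    then show "eta (measure N (Y -` {h v} \<inter> space N)) = eta (measure N (X -` {v} \<inter> space N))"
      by simp
  qed
  finally show ?thesis ..
qed

lemma fcent_kernel:
  assumes "\<And>x y. x \<in> space N \<Longrightarrow> y \<in> space N \<Longrightarrow> X x = X y \<longleftrightarrow> X' x = X' y"
    and "\<And>x y. x \<in> space N \<Longrightarrow> y \<in> space N \<Longrightarrow> Y x = Y y \<longleftrightarrow> Y' x = Y' y"
  shows "fcent N X Y = fcent N X' Y'"
  unfolding fcent_def using assms
  by (intro arg_cong2[where f="(-)"] fent_kernel) auto

section \<open>Monotonicity and stability of conditional entropy\<close>

context prob_space
begin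

lemma sum_measure_fibres:
  assumes "simple_function M W"
  shows "measure M ((\<lambda>x. f (W x)) -` {u} \<inter> space M) =
    (\<Sum>w\<in>{w \<in> W ` space M. f w = u}. measure M (W -` {w} \<inter> space M))"
proof -
  have "(\<lambda>x. f (W x)) -` {u} \<inter> space M =
      (\<Union>w\<in>{w \<in> W ` space M. f w = u}. W -` {w} \<inter> space M)"
    by auto
  moreover have "measure M (\<Union>w\<in>{w \<in> W ` space M. f w = u}. W -` {w} \<inter> space M) =
      (\<Sum>w\<in>{w \<in> W ` space M. f w = u}. measure M (W -` {w} \<inter> space M))"
    using assms by (intro finite_measure_finite_Union)
      (auto simp: disjoint_family_on_def dest: simple_functionD)
  ultimately show ?thesis by simp
qed

lemma sum_measure_simple:
  assumes "simple_function M W"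
  shows "(\<Sum>w\<in>W ` space M. measure M (W -` {w} \<inter> space M)) = 1"
  using sum_measure_fibres[OF assms, of "\<lambda>_. ()" "()"] prob_space by (simp add: vimage_def)

text \<open>Entropies of several factors of one function \<open>W\<close> become sums over the same
  range with the same weights, so they can be compared term by term.\<close>

lemma fent_factor:
  assumes "simple_function M W"
  shows "fent M (\<lambda>x. f (W x)) = - (\<Sum>w\<in>W ` space M. measure M (W -` {w} \<inter> space M) *
    ln (measure M ((\<lambda>x. f (W x)) -` {f w} \<inter> space M)))" (is "_ = - sum ?t _")
proof -
  have "(\<Sum>w\<in>W ` space M. ?t w) =
      (\<Sum>u\<in>f ` W ` space M. \<Sum>w\<in>{w \<in> W ` space M. f w = u}. ?t w)"
    using assms by (intro sum.image_gen) (auto dest: simple_functionD)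
  also have "\<dots> = (\<Sum>u\<in>f ` W ` space M. - eta (measure M ((\<lambda>x. f (W x)) -` {u} \<inter> space M)))"
  proof (rule sum.cong[OF refl])
    fix u
    have "(\<Sum>w\<in>{w \<in> W ` space M. f w = u}. ?t w) =
        (\<Sum>w\<in>{w \<in> W ` space M. f w = u}. measure M (W -` {w} \<inter> space M)) *
        ln (measure M ((\<lambda>x. f (W x)) -` {u} \<inter> space M))"
      by (simp add: sum_distrib_right)
    then show "(\<Sum>w\<in>{w \<in> W ` space M. f w = u}. ?t w) =
        - eta (measure M ((\<lambda>x. f (W x)) -` {u} \<inter> space M))"
      by (simp only: sum_measure_fibres[OF assms, symmetric] eta_def minus_minus)
  qed
  finally show ?thesis
    by (simp add: fent_def image_image sum_negf)
qed

lemma fent_le_card: "fent M X \<le> real (card (X ` space M))"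
  unfolding fent_def
  using sum_bounded_above[of "X ` space M" "\<lambda>v. eta (measure M (X -` {v} \<inter> space M))" 1]
  by (simp add: eta_le_1)

lemma fent_const: "fent M (\<lambda>x. c) = 0"
  using not_empty prob_space by (simp add: fent_def image_constant_conv)

text \<open>A joint atom is no larger than the atom of \<open>Y\<close> that contains it, so the
  logarithms compare term by term; null atoms carry weight 0.\<close>

lemma fcent_nonneg:
  assumes X: "simple_function M X" and Y: "simple_function M Y"
  shows "0 \<le> fcent M X Y"
proof -
  let ?W = "\<lambda>x. (X x, Y x)"
  have W: "simple_function M ?W" using X Y by simp
  have "(\<Sum>w\<in>?W ` space M. measure M (?W -` {w} \<inter> space M) *
        ln (measure M (?W -` {w} \<inter> space M))) \<le>
      (\<Sum>w\<in>?W ` space M. measure M (?W -` {w} \<inter> space M) *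
        ln (measure M (Y -` {snd w} \<inter> space M)))"
  proof (rule sum_mono)
    fix w assume "w \<in> ?W ` space M"
    have le: "measure M (?W -` {w} \<inter> space M) \<le> measure M (Y -` {snd w} \<inter> space M)"
      using simple_functionD(2)[OF Y] by (intro finite_measure_mono) auto
    show "measure M (?W -` {w} \<inter> space M) * ln (measure M (?W -` {w} \<inter> space M)) \<le>
        measure M (?W -` {w} \<inter> space M) * ln (measure M (Y -` {snd w} \<inter> space M))"
    proof (cases "measure M (?W -` {w} \<inter> space M) = 0")
      case False
      then have "0 < measure M (?W -` {w} \<inter> space M)" by (simp add: zero_less_measure_iff)
      with le show ?thesis by (intro mult_left_mono) (auto intro: ln_mono)
    qed simp
  qed
  then show ?thesis
    using fent_factor[OF W, of "\<lambda>w. w"] fent_factor[OF W, of snd]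
    by (simp add: fcent_def)
qed

text \<open>Strong subadditivity, from \<open>ln t \<le> t - 1\<close> applied to
  \<open>t = p(x,y) p(y,z) / (p(x,y,z) p(y))\<close>.\<close>

lemma fcent_antimono:
  assumes X: "simple_function M X" and Y: "simple_function M Y" and Z: "simple_function M Z"
  shows "fcent M X (\<lambda>x. (Y x, Z x)) \<le> fcent M X Y"
proof -
  define W where "W = (\<lambda>x. (X x, Y x, Z x))"
  define R where "R = W ` space M"
  define p where "p w = measure M (W -` {w} \<inter> space M)" for w
  define pXY where "pXY u = measure M ((\<lambda>x. (X x, Y x)) -` {u} \<inter> space M)" for u
  define pYZ where "pYZ u = measure M ((\<lambda>x. (Y x, Z x)) -` {u} \<inter> space M)" for u
  define pY where "pY u = measure M (Y -` {u} \<inter> space M)" for u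
  have W: "simple_function M W" unfolding W_def using X Y Z by simp
  have XY: "simple_function M (\<lambda>x. (X x, Y x))" and YZ: "simple_function M (\<lambda>x. (Y x, Z x))"
    using X Y Z by auto
  let ?xy = "\<lambda>w. (fst w, fst (snd w))" and ?yz = "snd" and ?y = "\<lambda>w. fst (snd w)"
  note fac = fent_factor[OF W, of "\<lambda>w. w"] fent_factor[OF W, of ?xy] fent_factor[OF W, of snd]
    fent_factor[OF W, of ?y]
  have eqs: "fent M W = - (\<Sum>w\<in>R. p w * ln (p w))"
    "fent M (\<lambda>x. (X x, Y x)) = - (\<Sum>w\<in>R. p w * ln (pXY (?xy w)))"
    "fent M (\<lambda>x. (Y x, Z x)) = - (\<Sum>w\<in>R. p w * ln (pYZ (?yz w)))"
    "fent M Y = - (\<Sum>w\<in>R. p w * ln (pY (?y w)))"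
    using fac unfolding R_def p_def pXY_def pYZ_def pY_def by (simp_all add: W_def)
  have termle: "p w * (ln (pXY (?xy w)) + ln (pYZ (?yz w)) - ln (p w) - ln (pY (?y w)))
      \<le> pXY (?xy w) * pYZ (?yz w) / pY (?y w) - p w" if "w \<in> R" for w
  proof (cases "p w = 0")
    case True
    then show ?thesis by (simp add: pXY_def pYZ_def pY_def)
  next
    case False
    then have pos: "p w > 0" by (simp add: p_def zero_less_measure_iff)
    have "p w \<le> pXY (?xy w)" "p w \<le> pYZ (?yz w)" "p w \<le> pY (?y w)"
      unfolding p_def pXY_def pYZ_def pY_def
      using simple_functionD(2)[OF XY] simple_functionD(2)[OF YZ] simple_functionD(2)[OF Y]
      by (intro finite_measure_mono; auto simp: W_def)+
    with pos have pos': "pXY (?xy w) > 0" "pYZ (?yz w) > 0" "pY (?y w) > 0" by linarith+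
    let ?t = "pXY (?xy w) * pYZ (?yz w) / (p w * pY (?y w))"
    have "ln ?t \<le> ?t - 1" using pos pos' by (intro ln_le_minus_one) simp
    moreover have "ln ?t = ln (pXY (?xy w)) + ln (pYZ (?yz w)) - ln (p w) - ln (pY (?y w))"
      using pos pos' by (simp add: ln_div ln_mult)
    ultimately have "p w * (ln (pXY (?xy w)) + ln (pYZ (?yz w)) - ln (p w) - ln (pY (?y w)))
        \<le> p w * (?t - 1)" using pos by (intro mult_left_mono) auto
    also have "\<dots> = pXY (?xy w) * pYZ (?yz w) / pY (?y w) - p w"
      using pos pos' by (simp add: field_simps)
    finally show ?thesis .
  qed
  define A where "A = (\<lambda>x. (X x, Y x)) ` space M"
  define C where "C = Z ` space M"
  \<comment> \<open>The bounds from \<open>termle\<close> are to be summed over \<open>R\<close>.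
    Their products are nonnegative, so that sum may be enlarged to all pairs in
    \<open>A \<times> C\<close>, where the sum over \<open>c\<close> can be taken first.\<close>
  have RAC: "R \<subseteq> (\<lambda>(a, c). (fst a, snd a, c)) ` (A \<times> C)"
  proof
    fix w assume "w \<in> R"
    then obtain x where "x \<in> space M" "w = W x" by (auto simp: R_def)
    then show "w \<in> (\<lambda>(a, c). (fst a, snd a, c)) ` (A \<times> C)"
      by (intro image_eqI[of _ _ "((X x, Y x), Z x)"]) (auto simp: W_def A_def C_def)
  qed
  have finA: "finite A" and finC: "finite C"
    unfolding A_def C_def using XY Z by (auto dest: simple_functionD)
  have inner: "(\<Sum>c\<in>C. pXY a * pYZ (snd a, c) / pY (snd a)) \<le> pXY a" for a
  proof -
    have "(\<Sum>c\<in>C. pYZ (snd a, c)) \<le> pY (snd a)"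
    proof -
      have "(\<Sum>c\<in>C. pYZ (snd a, c)) =
          measure M (\<Union>c\<in>C. (\<lambda>x. (Y x, Z x)) -` {(snd a, c)} \<inter> space M)"
        unfolding pYZ_def using finC simple_functionD(2)[OF YZ]
        by (intro finite_measure_finite_Union[symmetric]) (auto simp: disjoint_family_on_def)
      also have "\<dots> \<le> pY (snd a)"
        unfolding pY_def using simple_functionD(2)[OF Y] by (intro finite_measure_mono) auto
      finally show ?thesis .
    qed
    then have "pXY a / pY (snd a) * (\<Sum>c\<in>C. pYZ (snd a, c)) \<le> pXY a / pY (snd a) * pY (snd a)"
      by (intro mult_left_mono) (auto simp: pXY_def pY_def)
    \<comment> \<open>Null atoms of \<open>Y\<close> cause no trouble because division by 0 yields
      0.\<close>
    also have "\<dots> \<le> pXY a" by (cases "pY (snd a) = 0") (auto simp: pXY_def)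
    finally show ?thesis by (simp add: sum_distrib_left)
  qed
  have "(\<Sum>w\<in>R. pXY (?xy w) * pYZ (?yz w) / pY (?y w)) \<le>
      (\<Sum>w\<in>(\<lambda>(a, c). (fst a, snd a, c)) ` (A \<times> C). pXY (?xy w) * pYZ (?yz w) / pY (?y w))"
    by (rule sum_mono2)
      (use finA finC RAC in \<open>auto simp: pXY_def pYZ_def pY_def\<close>)
  also have "\<dots> = (\<Sum>(a, c)\<in>A \<times> C. pXY a * pYZ (snd a, c) / pY (snd a))"
    by (subst sum.reindex) (auto simp: inj_on_def case_prod_unfold intro!: sum.cong)
  also have "\<dots> = (\<Sum>a\<in>A. \<Sum>c\<in>C. pXY a * pYZ (snd a, c) / pY (snd a))"
    by (rule sum.cartesian_product[symmetric])
  also have "\<dots> \<le> (\<Sum>a\<in>A. pXY a)" by (intro sum_mono inner)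
  also have "\<dots> = 1" unfolding A_def pXY_def by (rule sum_measure_simple[OF XY])
  also have "1 = (\<Sum>w\<in>R. p w)" unfolding R_def p_def by (rule sum_measure_simple[OF W, symmetric])
  finally have "(\<Sum>w\<in>R. pXY (?xy w) * pYZ (?yz w) / pY (?y w) - p w) \<le> 0"
    by (simp add: sum_subtractf)
  then have
    "(\<Sum>w\<in>R. p w * (ln (pXY (?xy w)) + ln (pYZ (?yz w)) - ln (p w) - ln (pY (?y w)))) \<le> 0"
    by (rule order_trans[OF sum_mono[OF termle], rotated])
  then have "fent M W + fent M Y \<le> fent M (\<lambda>x. (X x, Y x)) + fent M (\<lambda>x. (Y x, Z x))"
    unfolding eqs by (simp add: algebra_simps sum.distrib sum_subtractf)
  then show ?thesis by (simp add: fcent_def W_def)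
qed

text \<open>If \<open>Z\<close> determines \<open>Y\<close>, then the pair of both has the same
  level sets as \<open>Z\<close>.\<close>

lemma fcent_antimono_factor:
  assumes "simple_function M X" "simple_function M Y" "simple_function M Z"
    and "\<And>x y. x \<in> space M \<Longrightarrow> y \<in> space M \<Longrightarrow> Z x = Z y \<Longrightarrow> Y x = Y y"
  shows "fcent M X Z \<le> fcent M X Y"
proof -
  have "fcent M X Z = fcent M X (\<lambda>x. (Y x, Z x))"
    by (rule fcent_kernel) (simp, metis assms(4) prod.inject)
  also have "\<dots> \<le> fcent M X Y"
    by (rule fcent_antimono[OF assms(1-3)])
  finally show ?thesis .
qed

lemma fcent_le_card:
  assumes "simple_function M X" "simple_function M Y"
  shows "fcent M X Y \<le> real (card (X ` space M))"
proof -
  have "fcent M X Y \<le> fcent M X (\<lambda>_. ())"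
    by (rule fcent_antimono_factor) (use assms in auto)
  also have "\<dots> = fent M X"
    unfolding fcent_def fent_const diff_zero by (rule fent_kernel) auto
  finally show ?thesis using fent_le_card[of X] by simp
qed

text \<open>Level sets with the same label differ in measure by less than \<open>d\<close>. Here the
  labels themselves matter, not only the partitions: the functions are compared value by
  value.\<close>

lemma fent_diff_le:
  fixes d e :: real
  assumes X: "simple_function M X" and Y: "simple_function M Y"
    and V: "finite V" "X ` space M \<subseteq> V" "Y ` space M \<subseteq> V"
    and d: "\<And>s t. s \<in> {0..1} \<Longrightarrow> t \<in> {0..1} \<Longrightarrow> \<bar>s - t\<bar> < d \<Longrightarrow> \<bar>eta s - eta t\<bar> < e"
    and neq: "measure M {x\<in>space M. X x \<noteq> Y x} < d"
  shows "\<bar>fent M X - fent M Y\<bar> \<le> real (card V) * e"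
proof -
  have D: "{x\<in>space M. X x \<noteq> Y x} \<in> sets M"
  proof -
    have "{x\<in>space M. X x \<noteq> Y x} = (\<lambda>x. (X x, Y x)) -` {u. fst u \<noteq> snd u} \<inter> space M" by auto
    also have "\<dots> \<in> sets M" using X Y by (intro simple_functionD) simp
    finally show ?thesis .
  qed
  have "\<bar>eta (measure M (X -` {v} \<inter> space M)) - eta (measure M (Y -` {v} \<inter> space M))\<bar> \<le> e" for v
  proof -
    have mX: "X -` {v} \<inter> space M \<in> sets M" and mY: "Y -` {v} \<inter> space M \<in> sets M"
      using X Y by (auto dest: simple_functionD)
    have "measure M (X -` {v} \<inter> space M) \<le>
        measure M ((Y -` {v} \<inter> space M) \<union> {x\<in>space M. X x \<noteq> Y x})"
      using mY D by (intro finite_measure_mono) auto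
    also have "\<dots> \<le> measure M (Y -` {v} \<inter> space M) + measure M {x\<in>space M. X x \<noteq> Y x}"
      using mY D by (rule measure_Un_le)
    finally have 1: "measure M (X -` {v} \<inter> space M) <  measure M (Y -` {v} \<inter> space M) + d"
      using neq by simp
    have "measure M (Y -` {v} \<inter> space M) \<le>
        measure M ((X -` {v} \<inter> space M) \<union> {x\<in>space M. X x \<noteq> Y x})"
      using mX D by (intro finite_measure_mono) auto
    also have "\<dots> \<le> measure M (X -` {v} \<inter> space M) + measure M {x\<in>space M. X x \<noteq> Y x}"
      using mX D by (rule measure_Un_le)
    finally have "measure M (Y -` {v} \<inter> space M) <  measure M (X -` {v} \<inter> space M) + d"
      using neq by simp
    with 1 show ?thesis by (intro less_imp_le d) auto
  qed
  then have "\<bar>\<Sum>v\<in>V. eta (measure M (X -` {v} \<inter> space M)) - eta (measure M (Y -` {v} \<inter> space M))\<bar>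
      \<le> real (card V) * e"
    by (intro order_trans[OF sum_abs] sum_bounded_above)
  then show ?thesis using V by (simp add: fent_superset[of V] sum_subtractf)
qed

end

section \<open>Partitions and conditional entropy\<close>

text \<open>The union has a single member when \<open>Q\<close> is a partition. As a function of
  \<open>x\<close> this is the label function that turns partitions into arguments of
  \<open>fent\<close>.\<close>

definition cell :: "'a set set \<Rightarrow> 'a \<Rightarrow> 'a set" where
  "cell Q x = \<Union>{A \<in> Q. x \<in> A}"

lemma cell_eq:
  assumes "partition_on \<Omega> Q" "A \<in> Q" "x \<in> A"
  shows "cell Q x = A"
proof -
  have "{A \<in> Q. x \<in> A} = {A}"
    using assms by (auto simp: partition_on_def disjoint_def)
  then show ?thesis by (simp add: cell_def)
qed

lemma
  assumes "partition_on \<Omega> Q" "x \<in> \<Omega>"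
  shows cell_in: "cell Q x \<in> Q" and in_cell: "x \<in> cell Q x"
proof -
  obtain A where "A \<in> Q" "x \<in> A" using assms by (auto simp: partition_on_def)
  with cell_eq[OF assms(1)] show "cell Q x \<in> Q" "x \<in> cell Q x" by auto
qed

lemma cell_image:
  assumes "partition_on \<Omega> Q"
  shows "cell Q ` \<Omega> = Q"
proof (intro equalityI subsetI)
  fix A assume "A \<in> Q"
  moreover from this obtain x where "x \<in> A" using assms by (metis partition_onD3 ex_in_conv)
  ultimately show "A \<in> cell Q ` \<Omega>"
    using cell_eq[OF assms] partition_onD1[OF assms] by (intro image_eqI[of _ _ x]) auto
qed (use cell_in[OF assms] in auto)

lemma cell_vimage:
  assumes "partition_on \<Omega> Q" "A \<in> Q"
  shows "cell Q -` {A} \<inter> \<Omega> = A"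
  using assms in_cell[OF assms(1)] cell_eq[OF assms] partition_onD1[OF assms(1)] by auto

lemma part_entropy_eq_fent:
  assumes "partition_on (space N) Q"
  shows "part_entropy N Q = fent N (cell Q)"
  unfolding part_entropy_def fent_def cell_image[OF assms] sum_negf[symmetric] eta_def
  by (intro sum.cong) (simp_all add: cell_vimage[OF assms])

lemma cell_common_refinement:
  assumes "\<And>Q. Q \<in> \<Q> \<Longrightarrow> partition_on \<Omega> Q" "\<Q> \<noteq> {}" "x \<in> \<Omega>"
  shows "cell (common_refinement \<Q>) x = (\<Inter>Q\<in>\<Q>. cell Q x)"
proof (rule cell_eq[OF partition_on_common_refinement[OF assms(1,2)]])
  show "x \<in> (\<Inter>Q\<in>\<Q>. cell Q x)" using in_cell[OF assms(1) assms(3)] by auto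
  then show "(\<Inter>Q\<in>\<Q>. cell Q x) \<in> common_refinement \<Q>"
    unfolding common_refinement using cell_in[OF assms(1) assms(3)]
    by (auto intro!: bexI[of _ "\<lambda>Q. cell Q x"])
qed

lemma cell_common_refinement_eq_iff:
  assumes Q: "\<And>Q. Q \<in> \<Q> \<Longrightarrow> partition_on \<Omega> Q" "\<Q> \<noteq> {}" and xy: "x \<in> \<Omega>" "y \<in> \<Omega>"
  shows "cell (common_refinement \<Q>) x = cell (common_refinement \<Q>) y \<longleftrightarrow>
    (\<forall>Q\<in>\<Q>. cell Q x = cell Q y)"
proof
  assume *: "cell (common_refinement \<Q>) x = cell (common_refinement \<Q>) y"
  show "\<forall>Q\<in>\<Q>. cell Q x = cell Q y"
  proof
    fix R assume R: "R \<in> \<Q>"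
    have "y \<in> cell (common_refinement \<Q>) x"
      unfolding * by (rule in_cell[OF partition_on_common_refinement[OF Q] xy(2)])
    then have "y \<in> cell R x" using R by (auto simp: cell_common_refinement[OF Q xy(1)])
    then show "cell R x = cell R y"
      using cell_eq[OF Q(1)[OF R] cell_in[OF Q(1)[OF R] xy(1)]] by simp
  qed
qed (simp add: cell_common_refinement[OF Q] xy)

text \<open>Moves the definition from joins of partitions to label functions, where pairs replace
  common refinements.\<close>

lemma cond_part_entropy_eq:
  assumes "partition_on (space N) P"
  shows "cond_part_entropy N P \<Theta> =
    (INF Q\<in>{Q. measurable_partition N \<Theta> Q}. fcent N (cell P) (cell Q))"
  unfolding cond_part_entropy_def
proof (rule INF_cong[OF refl])
  fix Q assume "Q \<in> {Q. measurable_partition N \<Theta> Q}"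
  then have Q: "partition_on (space N) Q" by (simp add: measurable_partition_def)
  have PQ: "\<And>R. R \<in> {P, Q} \<Longrightarrow> partition_on (space N) R" "{P, Q} \<noteq> {}" using assms Q by auto
  have "part_entropy N (common_refinement {P, Q}) = fent N (cell (common_refinement {P, Q}))"
    by (rule part_entropy_eq_fent[OF partition_on_common_refinement[OF PQ]])
  also have "\<dots> = fent N (\<lambda>x. (cell P x, cell Q x))"
  proof (rule fent_kernel)
    fix x y assume xy: "x \<in> space N" "y \<in> space N"
    show "cell (common_refinement {P, Q}) x = cell (common_refinement {P, Q}) y \<longleftrightarrow>
        (cell P x, cell Q x) = (cell P y, cell Q y)"
      by (subst cell_common_refinement_eq_iff[OF PQ xy]) auto
  qed
  finally show "part_entropy N (common_refinement {P, Q}) - part_entropy N Q = fcent N (cell P) (cell Q)"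
    by (simp add: fcent_def part_entropy_eq_fent[OF Q])
qed

lemma simple_function_cell:
  assumes "measurable_partition N (sets B) Q" "space B = space N"
  shows "simple_function B (cell Q)"
  using assms cell_image[of "space N" Q] cell_vimage[of "space N" Q]
  by (auto simp: simple_function_def measurable_partition_def)

text \<open>The way back from label functions to partitions, over which the infimum in the
  conditional entropy ranges.\<close>

definition fibres :: "'a set \<Rightarrow> ('a \<Rightarrow> 'b) \<Rightarrow> 'a set set" where
  "fibres \<Omega> c = (\<lambda>v. c -` {v} \<inter> \<Omega>) ` (c ` \<Omega>)"

lemma partition_on_fibres: "partition_on \<Omega> (fibres \<Omega> c)"
  by (rule partition_onI) (auto simp: fibres_def disjnt_def)

lemma cell_fibres:
  assumes "x \<in> \<Omega>"
  shows "cell (fibres \<Omega> c) x = c -` {c x} \<inter> \<Omega>"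
  using assms by (intro cell_eq[OF partition_on_fibres]) (auto simp: fibres_def)

lemma cell_fibres_eq_iff:
  assumes "x \<in> \<Omega>" "y \<in> \<Omega>"
  shows "cell (fibres \<Omega> c) x = cell (fibres \<Omega> c) y \<longleftrightarrow> c x = c y"
  using assms by (auto simp: cell_fibres)

lemma measurable_partition_fibres:
  assumes "simple_function B c" "space B = space N"
  shows "measurable_partition N (sets B) (fibres (space N) c)"
  unfolding measurable_partition_def
  using assms partition_on_fibres[of "space N" c]
  by (auto simp: fibres_def simple_function_def)

section \<open>Conditional entropy given a sub-sigma-algebra\<close>

context prob_space
begin

text \<open>The infimum is taken in the reals, where it is meaningful only for sets bounded
  below.\<close>

lemma bdd_below_fcent:
  assumes "simple_function M X" "\<And>Q. Q \<in> \<Q> \<Longrightarrow> simple_function M (Y Q)"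
  shows "bdd_below ((\<lambda>Q. fcent M X (Y Q)) ` \<Q>)"
  by (rule bdd_belowI[of _ 0]) (use assms fcent_nonneg in auto)

context
  fixes B P
  assumes B: "subalgebra M B" and P: "measurable_partition M (sets M) P"
begin

lemma simple_function_subalgebra_cell:
  assumes "measurable_partition M (sets B) Q"
  shows "simple_function B (cell Q)" "simple_function M (cell Q)"
proof -
  show *: "simple_function B (cell Q)"
    using assms B by (intro simple_function_cell) (auto simp: subalgebra_def)
  show "simple_function M (cell Q)"
    by (rule simple_function_subalgebra[OF *]) (use B in \<open>auto simp: subalgebra_def\<close>)
qed

text \<open>A simple function competes in the infimum through its fibres, which form a
  \<open>B\<close>-measurable partition.\<close>

lemma cond_part_entropy_le:
  assumes c: "simple_function B c"
  shows "cond_part_entropy M P (sets B) \<le> fcent M (cell P) c"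
proof -
  have sp: "space B = space M" using B by (simp add: subalgebra_def)
  have P': "partition_on (space M) P" using P by (simp add: measurable_partition_def)
  have "cond_part_entropy M P (sets B) \<le> fcent M (cell P) (cell (fibres (space M) c))"
    unfolding cond_part_entropy_eq[OF P']
    using measurable_partition_fibres[OF c sp]
    by (intro cINF_lower bdd_below_fcent simple_function_cell[OF P refl])
      (auto intro: simple_function_subalgebra_cell)
  also have "\<dots> = fcent M (cell P) c"
    by (intro fcent_kernel cell_fibres_eq_iff) auto
  finally show ?thesis .
qed

lemma cond_part_entropy_approx:
  assumes "e > 0"
  obtains Q where "measurable_partition M (sets B) Q"
    "fcent M (cell P) (cell Q) < cond_part_entropy M P (sets B) + e"
proof -
  have P': "partition_on (space M) P" using P by (simp add: measurable_partition_def)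
  \<comment> \<open>The trivial partition shows that the infimum is over a nonempty set.\<close>
  have "measurable_partition M (sets B) {space M}"
    using B not_empty sets.top[of B]
    by (auto simp: measurable_partition_def subalgebra_def intro: partition_on_space)
  then have ne: "{Q. measurable_partition M (sets B) Q} \<noteq> {}" by auto
  show ?thesis
    using cINF_less_iff[OF ne bdd_below_fcent[of "cell P" "{Q. measurable_partition M (sets B) Q}" cell],
      of "cond_part_entropy M P (sets B) + e"]
      assms simple_function_cell[OF P refl] simple_function_subalgebra_cell that
    unfolding cond_part_entropy_eq[OF P', symmetric] by auto
qed

text \<open>The infimum is attained in the limit along partitions on whose cells all conditional
  probabilities \<open>f v\<close> vary by less than \<open>d\<close>.\<close>

lemma fcent_near_integral:
  fixes d e :: real
  assumes W: "simple_function M W"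
    and f: "\<And>v. v \<in> P \<Longrightarrow> f v \<in> borel_measurable M"
      "\<And>v x. v \<in> P \<Longrightarrow> x \<in> space M \<Longrightarrow> f v x \<in> {0..1}"
      "\<And>x. x \<in> space M \<Longrightarrow> (\<Sum>v\<in>P. f v x) = 1"
    and int: "\<And>v w. v \<in> P \<Longrightarrow> w \<in> W ` space M \<Longrightarrow>
      measure M (v \<inter> (W -` {w} \<inter> space M)) = (\<integral>x. indicator (W -` {w} \<inter> space M) x * f v x \<partial>M)"
    and near: "\<And>v x y. v \<in> P \<Longrightarrow> x \<in> space M \<Longrightarrow> y \<in> space M \<Longrightarrow> W x = W y \<Longrightarrow>
      \<bar>f v x - f v y\<bar> \<le> d"
    and d: "\<And>s t. s \<in> {0..1} \<Longrightarrow> t \<in> {0..1} \<Longrightarrow> \<bar>s - t\<bar> \<le> d \<Longrightarrow> \<bar>eta s - eta t\<bar> \<le> e"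
  shows "\<bar>fcent M (cell P) W - (\<integral>x. (\<Sum>v\<in>P. eta (f v x)) \<partial>M)\<bar> \<le> real (card P) * e"
proof -
  have P': "partition_on (space M) P" and finP: "finite P" and PM: "P \<subseteq> sets M"
    using P by (auto simp: measurable_partition_def)
  define R where "R = W ` space M"
  define A where "A w = W -` {w} \<inter> space M" for w
  define b where "b w = measure M (A w)" for w
  \<comment> \<open>The conditional probability of \<open>v\<close> on the cell \<open>A w\<close>;
    on a null cell the division makes it 0, which still lies in the unit interval.\<close>
  define q where "q v w = measure M (v \<inter> A w) / b w" for v w
  define h where "h x = (\<Sum>v\<in>P. eta (f v x))" for x
  have finR: "finite R" unfolding R_def using W by (rule simple_functionD)
  have A: "A w \<in> sets M" for w unfolding A_def using W by (rule simple_functionD)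
  have eta_meas: "(\<lambda>x. eta (f v x)) \<in> borel_measurable M" if "v \<in> P" for v
    unfolding eta_def using f(1)[OF that] by measurable
  have eta_bd: "0 \<le> eta (f v x)" "eta (f v x) \<le> 1" if "v \<in> P" "x \<in> space M" for v x
    using f(2)[OF that] by (auto intro: eta_nonneg eta_le_1)
  have inteta: "integrable M (\<lambda>x. indicator (A w) x * eta (f v x))" if "v \<in> P" for v w
    using eta_meas[OF that] A[of w] eta_bd[OF that]
    by (intro integrable_const_bound[of _ 1]) (auto intro!: AE_I2 simp: indicator_def)
  have intf: "integrable M (\<lambda>x. indicator (A w) x * f v x)" if "v \<in> P" for v w
    using f(1)[OF that] f(2)[OF that] A[of w]
    by (intro integrable_const_bound[of _ 1]) (auto intro!: AE_I2 simp: indicator_def)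
  have bq: "b w * q v w = measure M (v \<inter> A w)" if "v \<in> P" for v w
  proof (cases "b w = 0")
    case True
    have "measure M (v \<inter> A w) \<le> b w" unfolding b_def using A by (intro finite_measure_mono) auto
    then show ?thesis using True by (simp add: measure_le_0_iff)
  qed (simp add: q_def)
  have q01: "q v w \<in> {0..1}" if "v \<in> P" for v w
  proof -
    have "measure M (v \<inter> A w) \<le> b w" unfolding b_def using A by (intro finite_measure_mono) auto
    moreover have "0 \<le> b w" by (simp add: b_def)
    ultimately show ?thesis by (auto simp: q_def divide_le_eq_1)
  qed
  have sumb: "(\<Sum>v\<in>P. measure M (v \<inter> A w)) = b w" for w
  proof -
    have "(\<Sum>v\<in>P. measure M (v \<inter> A w)) = measure M (\<Union>v\<in>P. v \<inter> A w)"
      using PM A finP disjointD[OF partition_onD2[OF P']]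
      by (intro finite_measure_finite_Union[symmetric]) (fastforce simp: disjoint_family_on_def)+
    also have "(\<Union>v\<in>P. v \<inter> A w) = A w" using partition_onD1[OF P'] by (auto simp: A_def)
    finally show ?thesis by (simp add: b_def)
  qed
  have fW: "fent M (\<lambda>x. (cell P x, W x)) = (\<Sum>w\<in>R. \<Sum>v\<in>P. eta (measure M (v \<inter> A w)))"
  proof -
    have "fent M (\<lambda>x. (cell P x, W x)) =
        (\<Sum>u\<in>P \<times> R. eta (measure M ((\<lambda>x. (cell P x, W x)) -` {u} \<inter> space M)))"
      using finP finR cell_in[OF P'] by (intro fent_superset) (auto simp: R_def)
    also have "\<dots> = (\<Sum>u\<in>P \<times> R. eta (measure M (fst u \<inter> A (snd u))))"
    proof (rule sum.cong[OF refl])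
      fix u assume "u \<in> P \<times> R"
      then have "cell P -` {fst u} \<inter> space M = fst u"
        by (intro cell_vimage[OF P']) auto
      moreover have "(\<lambda>x. (cell P x, W x)) -` {u} \<inter> space M =
          (cell P -` {fst u} \<inter> space M) \<inter> A (snd u)"
        unfolding A_def by (cases u) (simp add: set_eq_iff, blast)
      ultimately have "(\<lambda>x. (cell P x, W x)) -` {u} \<inter> space M = fst u \<inter> A (snd u)" by simp
      then show "eta (measure M ((\<lambda>x. (cell P x, W x)) -` {u} \<inter> space M)) =
          eta (measure M (fst u \<inter> A (snd u)))" by simp
    qed
    also have "\<dots> = (\<Sum>v\<in>P. \<Sum>w\<in>R. eta (measure M (v \<inter> A w)))"
      by (simp add: sum.cartesian_product case_prod_unfold)
    finally show ?thesis by (simp add: sum.swap[of _ R])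
  qed
  have cent: "fcent M (cell P) W = (\<Sum>w\<in>R. b w * (\<Sum>v\<in>P. eta (q v w)))"
  proof -
    have "(\<Sum>v\<in>P. eta (measure M (v \<inter> A w))) - eta (b w) = b w * (\<Sum>v\<in>P. eta (q v w))" for w
    proof (cases "b w = 0")
      case True
      then show ?thesis using bq by (simp flip: bq)
    next
      case False
      have "(\<Sum>v\<in>P. eta (measure M (v \<inter> A w))) = (\<Sum>v\<in>P. b w * eta (q v w) + q v w * eta (b w))"
      proof (rule sum.cong[OF refl])
        fix v assume v: "v \<in> P"
        show "eta (measure M (v \<inter> A w)) = b w * eta (q v w) + q v w * eta (b w)"
          unfolding bq[OF v, symmetric] using q01[OF v, of w] by (intro eta_mult) (auto simp: b_def)
      qed
      also have "\<dots> = b w * (\<Sum>v\<in>P. eta (q v w)) + (\<Sum>v\<in>P. q v w) * eta (b w)"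
        by (simp add: sum.distrib sum_distrib_left sum_distrib_right)
      also have "(\<Sum>v\<in>P. q v w) = 1"
        using False sumb[of w] by (simp add: q_def flip: sum_divide_distrib)
      finally show ?thesis by simp
    qed
    then show ?thesis unfolding fcent_def fW
      by (simp add: fent_def R_def[symmetric] A_def[symmetric] b_def[symmetric] flip: sum_subtractf)
  qed
  have "(\<integral>x. h x \<partial>M) = (\<integral>x. (\<Sum>w\<in>R. \<Sum>v\<in>P. indicator (A w) x * eta (f v x)) \<partial>M)"
  proof (rule Bochner_Integration.integral_cong[OF refl])
    fix x assume x: "x \<in> space M"
    have "(\<Sum>w\<in>R. indicator (A w) x * h x) = indicator (A (W x)) x * h x"
      using x finR by (subst sum.remove[of _ "W x"]) (auto simp: R_def A_def intro!: sum.neutral)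
    then show "h x = (\<Sum>w\<in>R. \<Sum>v\<in>P. indicator (A w) x * eta (f v x))"
      using x by (simp add: h_def A_def sum_distrib_left)
  qed
  also have "\<dots> = (\<Sum>w\<in>R. \<Sum>v\<in>P. \<integral>x. indicator (A w) x * eta (f v x) \<partial>M)"
    using inteta by (simp add: Bochner_Integration.integral_sum)
  finally have inth: "(\<integral>x. h x \<partial>M) = (\<Sum>w\<in>R. \<Sum>v\<in>P. \<integral>x. indicator (A w) x * eta (f v x) \<partial>M)" .
  have intc: "integrable M (\<lambda>x. indicator (A w) x * c)" for w and c :: real
    using A[of w] by (intro integrable_const_bound[of _ "\<bar>c\<bar>"]) (auto simp: indicator_def)
  have close: "\<bar>b w * eta (q v w) - (\<integral>x. indicator (A w) x * eta (f v x) \<partial>M)\<bar> \<le> b w * e"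
    if w: "w \<in> R" and v: "v \<in> P" for w v
  proof -
    \<comment> \<open>\<open>q v w\<close> is the mean of \<open>f v\<close> over the cell, and
      \<open>f v\<close> varies there by at most \<open>d\<close>.\<close>
    have qf: "\<bar>q v w - f v x\<bar> \<le> d" if x: "x \<in> A w" and b0: "b w \<noteq> 0" for x
    proof -
      have "\<bar>measure M (v \<inter> A w) - b w * f v x\<bar> =
          \<bar>\<integral>y. indicator (A w) y * f v y - indicator (A w) y * f v x \<partial>M\<bar>"
        using int[OF v, of w] w A
        by (subst Bochner_Integration.integral_diff[OF intf[OF v] intc])
          (simp_all add: R_def A_def[symmetric] b_def)
      also have "\<dots> \<le> (\<integral>y. \<bar>indicator (A w) y * f v y - indicator (A w) y * f v x\<bar> \<partial>M)"
        by (rule integral_abs_bound)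
      also have "\<dots> \<le> (\<integral>y. indicator (A w) y * d \<partial>M)"
        using x near[OF v, of _ x]
        by (intro integral_mono Bochner_Integration.integrable_abs Bochner_Integration.integrable_diff
            intf[OF v] intc) (auto simp: indicator_def A_def)
      also have "\<dots> = b w * d" using A by (simp add: b_def)
      finally have "\<bar>b w * q v w - b w * f v x\<bar> \<le> b w * d" by (simp add: bq[OF v])
      then have "b w * \<bar>q v w - f v x\<bar> \<le> b w * d"
        by (simp add: b_def flip: right_diff_distrib abs_mult_pos' abs_mult)
      moreover have "b w > 0" using b0 by (simp add: b_def zero_less_measure_iff)
      ultimately show ?thesis by simp
    qed
    have "\<bar>b w * eta (q v w) - (\<integral>x. indicator (A w) x * eta (f v x) \<partial>M)\<bar> =
        \<bar>\<integral>x. indicator (A w) x * eta (q v w) - indicator (A w) x * eta (f v x) \<partial>M\<bar>"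
      using A by (subst Bochner_Integration.integral_diff[OF intc inteta[OF v]]) (simp_all add: b_def)
    also have "\<dots> \<le> (\<integral>x. \<bar>indicator (A w) x * eta (q v w) - indicator (A w) x * eta (f v x)\<bar> \<partial>M)"
      by (rule integral_abs_bound)
    also have "\<dots> \<le> (\<integral>x. indicator (A w) x * e \<partial>M)"
    proof (rule integral_mono_AE)
      show "AE x in M. \<bar>indicator (A w) x * eta (q v w) - indicator (A w) x * eta (f v x)\<bar>
          \<le> indicator (A w) x * e"
      \<comment> \<open>On a null cell \<open>q v w\<close> is a default value that need not be
        close to \<open>f v\<close>, but there the integrand vanishes almost everywhere.\<close>
      proof (cases "b w = 0")
        case True
        then have "AE x in M. x \<notin> A w"
          using A[of w] by (intro AE_not_in) (simp add: b_def null_setsI emeasure_eq_measure)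
        then show ?thesis by eventually_elim auto
      next
        case False
        show ?thesis
        proof (rule AE_I2)
          fix x assume x: "x \<in> space M"
          have "\<bar>eta (q v w) - eta (f v x)\<bar> \<le> e" if "x \<in> A w"
            using q01[OF v] f(2)[OF v x] qf[OF that False] by (intro d) auto
          then show "\<bar>indicator (A w) x * eta (q v w) - indicator (A w) x * eta (f v x)\<bar>
              \<le> indicator (A w) x * e" by (auto simp: indicator_def)
        qed
      qed
    qed (intro Bochner_Integration.integrable_abs Bochner_Integration.integrable_diff inteta[OF v] intc)+
    also have "\<dots> = b w * e" using A by (simp add: b_def)
    finally show ?thesis .
  qed
  have "fcent M (cell P) W - (\<integral>x. h x \<partial>M) =
      (\<Sum>w\<in>R. \<Sum>v\<in>P. b w * eta (q v w) - (\<integral>x. indicator (A w) x * eta (f v x) \<partial>M))"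
    unfolding cent inth by (simp add: sum_distrib_left sum_subtractf)
  also have "\<bar>\<dots>\<bar> \<le> (\<Sum>w\<in>R. \<Sum>v\<in>P. b w * e)"
    by (intro order_trans[OF sum_abs] sum_mono order_trans[OF sum_abs] close)
  also have "\<dots> = (\<Sum>w\<in>R. b w) * (card P * e)"
    by (simp add: sum_distrib_right sum_distrib_left mult_ac)
  also have "(\<Sum>w\<in>R. b w) = 1"
    unfolding b_def R_def A_def by (rule sum_measure_simple[OF W])
  finally show ?thesis unfolding h_def by simp
qed

text \<open>The \<open>f v\<close> are versions of the conditional probabilities of the cells given
  \<open>B\<close>. Labelling points by the rounded values of all \<open>f v\<close> gives a finite
  \<open>B\<close>-measurable partition to which the previous estimate applies, and it still applies
  after any further refinement \<open>Y\<close>. Alone it bounds the infimum from above; joined with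
  a nearly optimal partition, which it can only improve, it bounds the infimum from below.\<close>

lemma cond_part_entropy_eq_integral:
  assumes f: "\<And>v. v \<in> P \<Longrightarrow> f v \<in> borel_measurable B"
      "\<And>v x. v \<in> P \<Longrightarrow> x \<in> space M \<Longrightarrow> f v x \<in> {0..1}"
      "\<And>x. x \<in> space M \<Longrightarrow> (\<Sum>v\<in>P. f v x) = 1"
    and int: "\<And>v A. v \<in> P \<Longrightarrow> A \<in> sets B \<Longrightarrow>
      measure M (v \<inter> A) = (\<integral>x. indicator A x * f v x \<partial>M)"
  shows "cond_part_entropy M P (sets B) = (\<integral>x. (\<Sum>v\<in>P. eta (f v x)) \<partial>M)" (is "?H = ?I")
proof -
  have P': "partition_on (space M) P" and finP: "finite P"
    using P by (auto simp: measurable_partition_def)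
  have sp: "space B = space M" and BM: "sets B \<subseteq> sets M" using B by (auto simp: subalgebra_def)
  have ne: "P \<noteq> {}" using partition_onD1[OF P'] not_empty by auto
  have sP: "simple_function M (cell P)" by (rule simple_function_cell[OF P refl])
  have main: "\<exists>Z :: 'a \<Rightarrow> 'a set \<Rightarrow> int. simple_function B Z \<and>
      (\<forall>Y :: 'a \<Rightarrow> 'a set. simple_function B Y \<longrightarrow> \<bar>fcent M (cell P) (\<lambda>x. (Z x, Y x)) - ?I\<bar> \<le> e)"
    if "e > 0" for e
  proof -
    have e': "e / card P > 0" using that ne finP by (simp add: card_gt_0_iff)
    obtain d where "d > 0" and
      d: "\<And>s t. s \<in> {0..1} \<Longrightarrow> t \<in> {0..1} \<Longrightarrow> \<bar>s - t\<bar> < d \<Longrightarrow> \<bar>eta s - eta t\<bar> < e / card P"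
      using eta_uniform[OF e'] by metis
    \<comment> \<open>Rounding to multiples of \<open>d / 2\<close>: equal labels force values
      within \<open>d / 2\<close>, safely below the strict bound \<open>d\<close> of uniform
      continuity.\<close>
    define Z where "Z x = (\<lambda>v\<in>P. \<lfloor>2 * f v x / d\<rfloor>)" for x
    have floor: "\<lfloor>2 * f v x / d\<rfloor> \<in> {0..\<lfloor>2 / d\<rfloor>}" if "v \<in> P" "x \<in> space M" for v x
      using f(2)[OF that] \<open>d > 0\<close> by (auto intro!: floor_mono divide_right_mono)
    have Z: "simple_function B Z"
      unfolding simple_function_def
    proof (intro conjI ballI)
      have "Z ` space B \<subseteq> PiE P (\<lambda>_. {0..\<lfloor>2 / d\<rfloor>})"
        using floor by (auto simp: Z_def sp)
      then show "finite (Z ` space B)" by (rule finite_subset) (simp add: finP finite_PiE)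
    next
      fix z assume "z \<in> Z ` space B"
      then have "Z -` {z} \<inter> space B = {x \<in> space B. \<forall>v\<in>P. \<lfloor>2 * f v x / d\<rfloor> = z v}"
        unfolding Z_def by (auto simp: extensional_def fun_eq_iff restrict_def split: if_splits)
      also have "\<dots> \<in> sets B"
      proof (rule sets.sets_Collect_finite_All'[OF _ finP ne])
        fix v assume v: "v \<in> P"
        have [measurable]: "f v \<in> borel_measurable B" by (rule f(1)[OF v])
        show "{x \<in> space B. \<lfloor>2 * f v x / d\<rfloor> = z v} \<in> sets B" by measurable
      qed
      finally show "Z -` {z} \<inter> space B \<in> sets B" .
    qed
    have "\<bar>fcent M (cell P) (\<lambda>x. (Z x, Y x)) - ?I\<bar> \<le> e"
      if Y: "simple_function B Y" for Y :: "'a \<Rightarrow> 'a set"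
    proof -
      have W: "simple_function B (\<lambda>x. (Z x, Y x))" using Z Y by simp
      have "\<bar>fcent M (cell P) (\<lambda>x. (Z x, Y x)) - ?I\<bar> \<le> card P * (e / card P)"
      proof (rule fcent_near_integral[where d = "d / 2"])
        show "simple_function M (\<lambda>x. (Z x, Y x))"
          by (rule simple_function_subalgebra[OF W BM sp])
        show "f v \<in> borel_measurable M" if "v \<in> P" for v
          using f(1)[OF that] measurable_from_subalg[OF B] by blast
        show "measure M (v \<inter> ((\<lambda>x. (Z x, Y x)) -` {w} \<inter> space M)) =
            (\<integral>x. indicator ((\<lambda>x. (Z x, Y x)) -` {w} \<inter> space M) x * f v x \<partial>M)"
          if "v \<in> P" for v w
          using simple_functionD(2)[OF W, of "{w}"] that by (intro int) (simp_all add: sp)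
        show "\<bar>f v x - f v y\<bar> \<le> d / 2"
          if "v \<in> P" "x \<in> space M" "y \<in> space M" "(Z x, Y x) = (Z y, Y y)" for v x y
        proof -
          have "\<lfloor>2 * f v x / d\<rfloor> = \<lfloor>2 * f v y / d\<rfloor>"
            using that(1,4) by (auto simp: Z_def dest: fun_cong[of _ _ v])
          then have "\<bar>2 * f v x / d - 2 * f v y / d\<bar> \<le> 1" by linarith
          then have "2 * f v x - 2 * f v y \<le> d" "2 * f v y - 2 * f v x \<le> d"
            using \<open>d > 0\<close> by (simp_all add: abs_le_iff field_simps)
          then show ?thesis by linarith
        qed
        show "\<bar>eta s - eta t\<bar> \<le> e / card P" if "s \<in> {0..1}" "t \<in> {0..1}" "\<bar>s - t\<bar> \<le> d / 2" for s t
          using d[OF that(1,2)] that(3) \<open>d > 0\<close> by force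
      qed (use f in auto)
      then show ?thesis using ne finP by simp
    qed
    then have "\<forall>Y :: 'a \<Rightarrow> 'a set. simple_function B Y \<longrightarrow>
        \<bar>fcent M (cell P) (\<lambda>x. (Z x, Y x)) - ?I\<bar> \<le> e" by (intro allI impI)
    with Z show ?thesis by (intro exI[of _ Z] conjI)
  qed
  show ?thesis
  proof (rule antisym)
    show "?H \<le> ?I"
    proof (rule field_le_epsilon)
      fix e :: real assume "e > 0"
      from main[OF this] obtain Z :: "'a \<Rightarrow> 'a set \<Rightarrow> int" where Z: "simple_function B Z" and
        near: "\<forall>Y :: 'a \<Rightarrow> 'a set. simple_function B Y \<longrightarrow> \<bar>fcent M (cell P) (\<lambda>x. (Z x, Y x)) - ?I\<bar> \<le> e"
        by (elim exE conjE) (rule that)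
      \<comment> \<open>A constant second component recovers \<open>Z\<close> alone.\<close>
      have "\<bar>fcent M (cell P) (\<lambda>x. (Z x, {} :: 'a set)) - ?I\<bar> \<le> e"
        by (rule near[THEN spec, THEN mp]) simp
      moreover have "?H \<le> fcent M (cell P) (\<lambda>x. (Z x, {} :: 'a set))"
        using Z by (intro cond_part_entropy_le) simp
      ultimately show "?H \<le> ?I + e" by linarith
    qed
    show "?I \<le> ?H"
    proof (rule field_le_epsilon)
      fix e :: real assume "e > 0"
      then have "e / 2 > 0" by simp
      from main[OF this] obtain Z :: "'a \<Rightarrow> 'a set \<Rightarrow> int" where Z: "simple_function B Z" and
        near: "\<forall>Y :: 'a \<Rightarrow> 'a set. simple_function B Y \<longrightarrow> \<bar>fcent M (cell P) (\<lambda>x. (Z x, Y x)) - ?I\<bar> \<le> e / 2"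
        by (elim exE conjE) (rule that)
      from cond_part_entropy_approx[OF \<open>e / 2 > 0\<close>] obtain Q where
        Q: "measurable_partition M (sets B) Q" "fcent M (cell P) (cell Q) < ?H + e / 2" .
      note cQ = simple_function_subalgebra_cell[OF Q(1)]
      have "fcent M (cell P) (\<lambda>x. (Z x, cell Q x)) \<le> fcent M (cell P) (cell Q)"
        using sP cQ simple_function_subalgebra[OF Z BM sp]
        by (intro fcent_antimono_factor) auto
      moreover have "\<bar>fcent M (cell P) (\<lambda>x. (Z x, cell Q x)) - ?I\<bar> \<le> e / 2"
        by (rule near[THEN spec, THEN mp, OF cQ(1)])
      ultimately show "?I \<le> ?H + e" using Q(2) by linarith
    qed
  qed
qed

end

end

section \<open>Approximation from a generating algebra\<close>

text \<open>The sets that can be approximated in measure form a sigma-algebra: a countable union is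
  first cut off at a finite stage and then approximated term by term. The induction keeps
  \<open>e\<close> arbitrary because the terms need smaller errors.\<close>

lemma (in finite_measure) algebra_approx:
  assumes alg: "algebra (space M) \<A>" and sub: "\<A> \<subseteq> sets M"
    and A: "A \<in> sigma_sets (space M) \<A>" and e: "e > 0"
  shows "\<exists>B\<in>\<A>. measure M ((A - B) \<union> (B - A)) < e"
  using A e
proof (induction arbitrary: e)
  case (Basic a)
  then show ?case by (intro bexI[of _ a]) auto
next
  case Empty
  interpret algebra "space M" \<A> by (rule alg)
  show ?case using Empty by (intro bexI[of _ "{}"]) auto
next
  case (Compl a)
  interpret algebra "space M" \<A> by (rule alg)
  obtain B where B: "B \<in> \<A>" "measure M ((a - B) \<union> (B - a)) < e" using Compl by blast
  have "a \<subseteq> space M" using Compl(1) sets.space_closed sub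
    by (metis sets.sigma_sets_subset subset_iff PowD)
  then have "(space M - a - (space M - B)) \<union> (space M - B - (space M - a)) = (a - B) \<union> (B - a)"
    using space_closed B(1) by auto
  then show ?case using B by (intro bexI[of _ "space M - B"]) auto
next
  case (Union a)
  interpret algebra "space M" \<A> by (rule alg)
  have a: "a i \<in> sets M" for i
    using Union(1)[of i] sub sets.sigma_sets_subset by blast
  have "(\<lambda>n. measure M (\<Union>i<n. a i)) \<longlonglongrightarrow> measure M (\<Union>n. \<Union>i<n. a i)"
    using a by (intro finite_Lim_measure_incseq) (force simp: incseq_def)+
  also have "(\<Union>n. \<Union>i<n. a i) = (\<Union>i. a i)" by blast
  finally have "\<forall>\<^sub>F n in sequentially. measure M (\<Union>i. a i) - e / 2 < measure M (\<Union>i<n. a i)"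
    using Union(3) by (intro order_tendstoD) auto
  then obtain n where n: "measure M (\<Union>i. a i) - e / 2 < measure M (\<Union>i<n. a i)"
    by (auto simp: eventually_sequentially)
  \<comment> \<open>Half of \<open>e\<close> is spent on cutting off the union. \<open>Suc n\<close>
    keeps the denominator positive when \<open>n = 0\<close>, and \<open>n\<close> such errors stay
    within the other half.\<close>
  have "\<exists>B\<in>\<A>. measure M ((a i - B) \<union> (B - a i)) < e / (2 * Suc n)" for i
    using Union(2)[of "e / (2 * Suc n)" i] Union(3) by simp
  then obtain B where B: "\<And>i. B i \<in> \<A>"
    "\<And>i. measure M ((a i - B i) \<union> (B i - a i)) < e / (2 * Suc n)"
    by metis
  have BM: "B i \<in> sets M" for i using B(1) sub by auto
  have "measure M (((\<Union>i. a i) - (\<Union>i<n. B i)) \<union> ((\<Union>i<n. B i) - (\<Union>i. a i))) \<le>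
      measure M (((\<Union>i. a i) - (\<Union>i<n. a i)) \<union> (\<Union>i<n. (a i - B i) \<union> (B i - a i)))"
    using a BM by (intro finite_measure_mono) auto
  also have "\<dots> \<le> measure M ((\<Union>i. a i) - (\<Union>i<n. a i)) +
      measure M (\<Union>i<n. (a i - B i) \<union> (B i - a i))"
    using a BM by (intro measure_Un_le) auto
  also have "measure M ((\<Union>i. a i) - (\<Union>i<n. a i)) < e / 2"
    using n a by (subst finite_measure_Diff) auto
  also have "measure M (\<Union>i<n. (a i - B i) \<union> (B i - a i)) \<le>
      (\<Sum>i<n. measure M ((a i - B i) \<union> (B i - a i)))"
    using a BM by (intro measure_UNION_le) auto
  also have "\<dots> \<le> (\<Sum>i<n. e / (2 * Suc n))"
    by (intro sum_mono less_imp_le B(2))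
  also have "\<dots> \<le> e / 2" using Union(3) by (simp add: field_simps)
  finally show ?case using B(1) by (intro bexI[of _ "\<Union>i<n. B i"]) auto
qed

text \<open>The sets \<open>D A\<close> may overlap or leave points uncovered. Recording all
  memberships still yields labels, and indexing them by \<open>Q\<close> keeps the labels for
  different choices of \<open>D\<close> comparable.\<close>

lemma simple_function_membership:
  assumes Q: "finite Q" and D: "\<And>A. A \<in> Q \<Longrightarrow> D A \<in> sets M"
  shows "simple_function M (\<lambda>x. {A \<in> Q. x \<in> D A})"
  unfolding simple_function_def
proof (intro conjI ballI)
  have "(\<lambda>x. {A \<in> Q. x \<in> D A}) ` space M \<subseteq> Pow Q" by auto
  then show "finite ((\<lambda>x. {A \<in> Q. x \<in> D A}) ` space M)"
    by (rule finite_subset) (simp add: Q)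
  fix U assume "U \<in> (\<lambda>x. {A \<in> Q. x \<in> D A}) ` space M"
  then have "(\<lambda>x. {A \<in> Q. x \<in> D A}) -` {U} \<inter> space M = {x \<in> space M. \<forall>A\<in>Q. x \<in> D A \<longleftrightarrow> A \<in> U}"
    by auto
  also have "\<dots> \<in> sets M"
  proof (rule sets.sets_Collect_finite_All[OF _ Q])
    fix A assume "A \<in> Q"
    then have [measurable]: "D A \<in> sets M" by (rule D)
    show "{x \<in> space M. x \<in> D A \<longleftrightarrow> A \<in> U} \<in> sets M" by measurable
  qed
  finally show "(\<lambda>x. {A \<in> Q. x \<in> D A}) -` {U} \<inter> space M \<in> sets M" .
qed

context prob_space
begin

text \<open>Each cell of a nearly optimal partition is replaced by a set of the algebra close to it
  in measure. The membership labels change only on a small set, which moves the entropies little.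
  Applied to cylinder sets this reduces conditioning on the whole past to finitely many coordinates,
  a role often played by martingale convergence.\<close>

lemma cond_part_entropy_approx_algebra:
  assumes B: "subalgebra M B" and P: "measurable_partition M (sets M) P"
    and alg: "algebra (space M) \<A>" and gen: "sets B = sigma_sets (space M) \<A>" and e: "e > 0"
  obtains \<E> where "finite \<E>" "\<E> \<subseteq> \<A>"
    "fcent M (cell P) (\<lambda>x. {E \<in> \<E>. x \<in> E}) < cond_part_entropy M P (sets B) + e"
proof -
  have P': "partition_on (space M) P" and finP: "finite P"
    using P by (auto simp: measurable_partition_def)
  have sP: "simple_function M (cell P)" by (rule simple_function_cell[OF P refl])
  have AM: "\<A> \<subseteq> sets M"
    using gen B sigma_sets_superset_generator[of \<A>] by (auto simp: subalgebra_def)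
  have "e / 2 > 0" using e by simp
  from cond_part_entropy_approx[OF B P this] obtain Q where
    Q: "measurable_partition M (sets B) Q"
      "fcent M (cell P) (cell Q) < cond_part_entropy M P (sets B) + e / 2" .
  have Q': "partition_on (space M) Q" and finQ: "finite Q" and QB: "Q \<subseteq> sets B"
    using Q(1) by (auto simp: measurable_partition_def)
  \<comment> \<open>Two entropies are perturbed: the joint one, with labels in \<open>V\<close>, and
    that of the condition, with labels in \<open>Pow Q\<close>. The choice of \<open>e'\<close>
    makes both errors together \<open>e / 4\<close>, on top of \<open>e / 2\<close> for the choice
    of \<open>Q\<close>.\<close>
  define V where "V = P \<times> Pow Q"
  define e' where "e' = e / (4 * (real (card V) + real (card (Pow Q))))"
  have "card (Pow Q) > 0" using finQ by (simp add: card_Pow)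
  then have pos: "real (card V) + real (card (Pow Q)) > 0" by linarith
  then have "e' > 0" unfolding e'_def using e by simp
  then obtain d where "d > 0" and
    d: "\<And>s t. s \<in> {0..1} \<Longrightarrow> t \<in> {0..1} \<Longrightarrow> \<bar>s - t\<bar> < d \<Longrightarrow> \<bar>eta s - eta t\<bar> < e'"
    using eta_uniform by metis
  \<comment> \<open>One error for each of the \<open>card Q\<close> cells; the added 1 makes their
    total strictly less than \<open>d\<close>.\<close>
  define d' where "d' = d / (real (card Q) + 1)"
  have "d' > 0" unfolding d'_def using \<open>d > 0\<close> by simp
  have "\<forall>A\<in>Q. \<exists>E\<in>\<A>. measure M ((A - E) \<union> (E - A)) < d'"
    using QB gen \<open>d' > 0\<close> by (intro ballI algebra_approx[OF alg AM]) auto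
  then obtain E where E: "\<And>A. A \<in> Q \<Longrightarrow> E A \<in> \<A>"
    "\<And>A. A \<in> Q \<Longrightarrow> measure M ((A - E A) \<union> (E A - A)) < d'"
    by metis
  define cQ where "cQ x = {A \<in> Q. x \<in> A}" for x
  define cE where "cE x = {A \<in> Q. x \<in> E A}" for x
  have QM: "A \<in> sets M" and EM: "E A \<in> sets M" if "A \<in> Q" for A
    using QB B E(1) AM that by (auto simp: subalgebra_def)
  have sQ: "simple_function M cQ" unfolding cQ_def using finQ QM by (rule simple_function_membership)
  have sE: "simple_function M cE" unfolding cE_def using finQ EM by (rule simple_function_membership)
  have neq: "measure M {x \<in> space M. cE x \<noteq> cQ x} < d"
  proof -
    have "measure M {x \<in> space M. cE x \<noteq> cQ x} \<le> measure M (\<Union>A\<in>Q. (A - E A) \<union> (E A - A))"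
      using QM EM finQ by (intro finite_measure_mono) (auto simp: cQ_def cE_def)
    also have "\<dots> \<le> (\<Sum>A\<in>Q. measure M ((A - E A) \<union> (E A - A)))"
      using QM EM finQ by (intro measure_UNION_le) auto
    also have "\<dots> \<le> (\<Sum>A\<in>Q. d')" by (intro sum_mono less_imp_le E(2))
    also have "\<dots> < d" using \<open>d > 0\<close> by (simp add: d'_def field_simps)
    finally show ?thesis .
  qed
  have "\<bar>fent M cE - fent M cQ\<bar> \<le> real (card (Pow Q)) * e'"
    by (rule fent_diff_le[OF sE sQ _ _ _ d neq]) (use finQ in \<open>auto simp: cE_def cQ_def\<close>)
  moreover have "\<bar>fent M (\<lambda>x. (cell P x, cE x)) - fent M (\<lambda>x. (cell P x, cQ x))\<bar> \<le> real (card V) * e'"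
  proof (rule fent_diff_le[OF simple_function_Pair[OF sP sE] simple_function_Pair[OF sP sQ] _ _ _ d])
    show "measure M {x \<in> space M. (cell P x, cE x) \<noteq> (cell P x, cQ x)} < d"
      using neq by simp
  qed (use finP finQ cell_in[OF P'] in \<open>auto simp: V_def cE_def cQ_def\<close>)
  moreover have "real (card V) * e' + real (card (Pow Q)) * e' = e / 4"
  proof -
    have "s * (e / (4 * s)) = e / 4" if "s > 0" for s :: real
      using that by (simp add: field_simps)
    from this[OF pos] show ?thesis by (simp only: distrib_right e'_def)
  qed
  ultimately have "fcent M (cell P) cE \<le> fcent M (cell P) cQ + e / 4"
    unfolding fcent_def by linarith
  also have "fcent M (cell P) cQ = fcent M (cell P) (cell Q)"
  proof (rule fcent_kernel[OF refl])
    have "cQ x = {cell Q x}" if "x \<in> space M" for x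
      unfolding cQ_def using cell_eq[OF Q', of _ x] cell_in[OF Q' that] in_cell[OF Q' that]
      by (intro equalityI subsetI) blast+
    then show "cQ x = cQ y \<longleftrightarrow> cell Q x = cell Q y" if "x \<in> space M" "y \<in> space M" for x y
      using that by simp
  qed
  \<comment> \<open>\<open>E\<close> may send several cells to one set, but both labels record the
    same memberships.\<close>
  also have "fcent M (cell P) cE = fcent M (cell P) (\<lambda>x. {D \<in> E ` Q. x \<in> D})"
    by (rule fcent_kernel[OF refl]) (auto simp: cE_def set_eq_iff)
  finally have "fcent M (cell P) (\<lambda>x. {D \<in> E ` Q. x \<in> D}) < cond_part_entropy M P (sets B) + e"
    using Q(2) e by linarith
  then show thesis using E(1) finQ by (intro that[of "E ` Q"]) auto
qed

end

section \<open>Factors carrying an equivariant random linear order\<close>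

text \<open>The argument uses no more of the order than its equivariance and measurability. It is
  applied with \<open>L r = r\<close> for the past and with \<open>L r = r\<inverse>\<close> for the future.\<close>

locale ordered_factor = group G for G (structure) +
  fixes M :: "'x measure" and T :: "'a \<Rightarrow> 'x \<Rightarrow> 'x"
    and N :: "'y measure" and S :: "'a \<Rightarrow> 'y \<Rightarrow> 'y"
    and \<phi> :: "'x \<Rightarrow> 'y" and \<kappa> :: "'y \<Rightarrow> 'x measure" and P :: "'x set set"
    and L :: "'y \<Rightarrow> 'a rel"
  assumes countable_carrier: "countable (carrier G)"
    and mp_M: "mp_action G M T" and mp_N: "mp_action G N S"
    and factor: "factor_map G M T N S \<phi>"
    and partition: "measurable_partition M (sets M) P"
    and disintegration: "disintegration M N \<phi> \<kappa>"
    and linear: "y \<in> space N \<Longrightarrow> strict_linear_order_on (carrier G) (L y)"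
    and measurable_order: "a \<in> carrier G \<Longrightarrow> b \<in> carrier G \<Longrightarrow> {y \<in> space N. (a, b) \<in> L y} \<in> sets N"
    and equivariant: "y \<in> space N \<Longrightarrow> a \<in> carrier G \<Longrightarrow> b \<in> carrier G \<Longrightarrow> g \<in> carrier G \<Longrightarrow>
      (a, b) \<in> L (S g y) \<longleftrightarrow> (a \<otimes> g, b \<otimes> g) \<in> L y"
begin

sublocale M: prob_space M
  using mp_M by (simp add: mp_action_def)

sublocale N: prob_space N
  using mp_N by (simp add: mp_action_def)

sublocale T: group_action G "space M" T
  using mp_M by (simp add: mp_action_def)

sublocale S: group_action G "space N" S
  using mp_N by (simp add: mp_action_def)

lemma measurable_T [measurable]: "g \<in> carrier G \<Longrightarrow> T g \<in> M \<rightarrow>\<^sub>M M"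
  and distr_T: "g \<in> carrier G \<Longrightarrow> distr M M (T g) = M"
  using mp_M by (auto simp: mp_action_def)

lemma measurable_S [measurable]: "g \<in> carrier G \<Longrightarrow> S g \<in> N \<rightarrow>\<^sub>M N"
  and distr_S: "g \<in> carrier G \<Longrightarrow> distr N N (S g) = N"
  using mp_N by (auto simp: mp_action_def)

lemma measurable_\<phi> [measurable]: "\<phi> \<in> M \<rightarrow>\<^sub>M N"
  and distr_\<phi>: "distr M N \<phi> = N"
  and \<phi>_equivariant: "g \<in> carrier G \<Longrightarrow> AE x in M. \<phi> (T g x) = S g (\<phi> x)"
  using factor by (auto simp: factor_map_def)

lemma T_space: "g \<in> carrier G \<Longrightarrow> x \<in> space M \<Longrightarrow> T g x \<in> space M"
  by (rule T.element_image) auto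

lemma S_space: "g \<in> carrier G \<Longrightarrow> y \<in> space N \<Longrightarrow> S g y \<in> space N"
  by (rule S.element_image) auto

lemma partition_P: "partition_on (space M) P" and finite_P: "finite P" and P_sets: "P \<subseteq> sets M"
  using partition by (auto simp: measurable_partition_def)

section \<open>Fibre measures and their equivariance\<close>

lemma \<kappa>:
  assumes "y \<in> space N"
  shows prob_space_\<kappa>: "prob_space (\<kappa> y)" and sets_\<kappa>: "sets (\<kappa> y) = sets M"
    and space_\<kappa>: "space (\<kappa> y) = space M"
proof -
  have "\<kappa> \<in> N \<rightarrow>\<^sub>M prob_algebra M"
    using disintegration by (simp add: disintegration_def)
  then have "\<kappa> y \<in> space (prob_algebra M)" using assms by (rule measurable_space)
  then show "prob_space (\<kappa> y)" "sets (\<kappa> y) = sets M" "space (\<kappa> y) = space M"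
    by (auto simp: space_prob_algebra dest: sets_eq_imp_space_eq)
qed

lemma simple_\<kappa>: "y \<in> space N \<Longrightarrow> simple_function M X \<Longrightarrow> simple_function (\<kappa> y) X"
  using simple_function_cong_algebra[OF sets_\<kappa> space_\<kappa>] by blast

lemma partition_\<kappa>: "y \<in> space N \<Longrightarrow> measurable_partition (\<kappa> y) (sets (\<kappa> y)) P"
  using partition by (simp add: measurable_partition_def sets_\<kappa> space_\<kappa>)

lemma measurable_emeasure_\<kappa> [measurable]:
  assumes "A \<in> sets M"
  shows "(\<lambda>y. emeasure (\<kappa> y) A) \<in> borel_measurable N"
proof -
  have "\<kappa> \<in> N \<rightarrow>\<^sub>M subprob_algebra M"
    using disintegration by (intro measurable_prob_algebraD) (simp add: disintegration_def)
  then show ?thesis using assms by (rule measurable_emeasure_kernel)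
qed

lemma measurable_measure_\<kappa> [measurable]:
  "A \<in> sets M \<Longrightarrow> (\<lambda>y. measure (\<kappa> y) A) \<in> borel_measurable N"
  unfolding measure_def by measurable

text \<open>For almost every \<open>y\<close> the measure \<open>\<kappa> y\<close> lives on the
  fibre over \<open>y\<close>, so cutting with the preimage of \<open>B\<close> keeps all of the
  mass of \<open>A\<close> or none of it.\<close>

lemma disintegration_Int:
  assumes A: "A \<in> sets M" and B: "B \<in> sets N"
  shows "emeasure M (A \<inter> \<phi> -` B) = (\<integral>\<^sup>+y. emeasure (\<kappa> y) A * indicator B y \<partial>N)"
proof -
  have "A \<inter> \<phi> -` B = A \<inter> (\<phi> -` B \<inter> space M)" using sets.sets_into_space[OF A] by auto
  then have AB: "A \<inter> \<phi> -` B \<in> sets M" using A B measurable_sets[OF measurable_\<phi> B] by auto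
  have "emeasure M (A \<inter> \<phi> -` B) = (\<integral>\<^sup>+y. emeasure (\<kappa> y) (A \<inter> \<phi> -` B) \<partial>N)"
    using disintegration AB by (simp add: disintegration_def)
  also have "\<dots> = (\<integral>\<^sup>+y. emeasure (\<kappa> y) A * indicator B y \<partial>N)"
  proof (rule nn_integral_cong_AE)
    have "AE y in N. AE x in \<kappa> y. \<phi> x = y"
      using disintegration by (simp add: disintegration_def)
    then show "AE y in N. emeasure (\<kappa> y) (A \<inter> \<phi> -` B) = emeasure (\<kappa> y) A * indicator B y"
    proof (rule AE_mp, intro AE_I2 impI)
      fix y assume y: "y \<in> space N" and ae: "AE x in \<kappa> y. \<phi> x = y"
      have "emeasure (\<kappa> y) (A \<inter> \<phi> -` B) = emeasure (\<kappa> y) (if y \<in> B then A else {})"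
        using ae by (intro emeasure_eq_AE) (use A AB sets_\<kappa>[OF y] in auto)
      then show "emeasure (\<kappa> y) (A \<inter> \<phi> -` B) = emeasure (\<kappa> y) A * indicator B y"
        by (auto simp: indicator_def)
    qed
  qed
  finally show ?thesis .
qed

text \<open>Both sides are conditional probabilities of the same set given \<open>N\<close>, so they agree almost
  everywhere.\<close>

lemma \<kappa>_equivariant:
  assumes A: "A \<in> sets M" and g: "g \<in> carrier G"
  shows "AE y in N. emeasure (\<kappa> y) (T g -` A \<inter> space M) = emeasure (\<kappa> (S g y)) A"
proof (rule N.density_unique2)
  note [measurable] = A
  have TA: "T g -` A \<inter> space M \<in> sets M" using measurable_sets[OF measurable_T[OF g] A] .
  then show "(\<lambda>y. emeasure (\<kappa> y) (T g -` A \<inter> space M)) \<in> borel_measurable N" by measurable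
  show "(\<lambda>y. emeasure (\<kappa> (S g y)) A) \<in> borel_measurable N"
    using measurable_compose[OF measurable_S[OF g] measurable_emeasure_\<kappa>[OF A]] .
  fix B assume B: "B \<in> sets N"
  \<comment> \<open>This is the image of \<open>B\<close> under \<open>S g\<close>, written as a
    preimage so that it is measurable.\<close>
  define B' where "B' = S (inv g) -` B \<inter> space N"
  have B': "B' \<in> sets N"
    unfolding B'_def using g B by (intro measurable_sets[OF measurable_S]) auto
  have SB': "S g y \<in> B' \<longleftrightarrow> y \<in> B" if "y \<in> space N" for y
    using S.orbit_sym_aux[OF g that refl] S_space[OF g that] by (simp add: B'_def)
  have AB': "A \<inter> \<phi> -` B' \<in> sets M" and AB: "(T g -` A \<inter> space M) \<inter> \<phi> -` B \<in> sets M"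
  proof -
    have "A \<inter> \<phi> -` B' = A \<inter> (\<phi> -` B' \<inter> space M)" using sets.sets_into_space[OF A] by auto
    then show "A \<inter> \<phi> -` B' \<in> sets M" using A measurable_sets[OF measurable_\<phi> B'] by auto
    have "(T g -` A \<inter> space M) \<inter> \<phi> -` B = (T g -` A \<inter> space M) \<inter> (\<phi> -` B \<inter> space M)" by auto
    then show "(T g -` A \<inter> space M) \<inter> \<phi> -` B \<in> sets M"
      using TA measurable_sets[OF measurable_\<phi> B] by auto
  qed
  have "(\<integral>\<^sup>+y. emeasure (\<kappa> (S g y)) A * indicator B y \<partial>N) =
      (\<integral>\<^sup>+y. emeasure (\<kappa> (S g y)) A * indicator B' (S g y) \<partial>N)"
    by (intro nn_integral_cong) (simp add: indicator_def SB')
  also have "\<dots> = (\<integral>\<^sup>+y. emeasure (\<kappa> y) A * indicator B' y \<partial>distr N N (S g))"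
    using B' by (subst nn_integral_distr) (auto intro!: measurable_S[OF g])
  also have "\<dots> = emeasure M (A \<inter> \<phi> -` B')"
    by (simp add: distr_S[OF g] disintegration_Int[OF A B'])
  also have "\<dots> = emeasure (distr M M (T g)) (A \<inter> \<phi> -` B')" by (simp add: distr_T[OF g])
  also have "\<dots> = emeasure M (T g -` (A \<inter> \<phi> -` B') \<inter> space M)"
    by (rule emeasure_distr[OF measurable_T[OF g] AB'])
  also have "\<dots> = emeasure M ((T g -` A \<inter> space M) \<inter> \<phi> -` B)"
  \<comment> \<open>\<open>\<phi>\<close> commutes with the action only almost everywhere, so the
    two sets agree up to a null set.\<close>
  proof (rule emeasure_eq_AE)
    show "AE x in M. x \<in> T g -` (A \<inter> \<phi> -` B') \<inter> space M \<longleftrightarrow> x \<in> (T g -` A \<inter> space M) \<inter> \<phi> -` B"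
      using \<phi>_equivariant[OF g]
    proof (rule AE_mp, intro AE_I2 impI)
      fix x assume x: "x \<in> space M" and eq: "\<phi> (T g x) = S g (\<phi> x)"
      have "\<phi> x \<in> space N" using measurable_space[OF measurable_\<phi> x] .
      then show "x \<in> T g -` (A \<inter> \<phi> -` B') \<inter> space M \<longleftrightarrow> x \<in> (T g -` A \<inter> space M) \<inter> \<phi> -` B"
        using x SB' by (simp add: eq)
    qed
  qed (use AB measurable_sets[OF measurable_T[OF g] AB'] in auto)
  also have "\<dots> = (\<integral>\<^sup>+y. emeasure (\<kappa> y) (T g -` A \<inter> space M) * indicator B y \<partial>N)"
    by (rule disintegration_Int[OF TA B])
  finally show "(\<integral>\<^sup>+y\<in>B. emeasure (\<kappa> y) (T g -` A \<inter> space M) \<partial>N) =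
      (\<integral>\<^sup>+y\<in>B. emeasure (\<kappa> (S g y)) A \<partial>N)" ..
qed

text \<open>A simple function has finitely many level sets, so the exceptional null sets, one for
  each of them, have a null union.\<close>

lemma fent_equivariant:
  assumes X: "simple_function M X" and g: "g \<in> carrier G"
  shows "AE y in N. fent (\<kappa> y) (\<lambda>x. X (T g x)) = fent (\<kappa> (S g y)) X"
proof -
  have fin: "finite (X ` space M)" using X by (rule simple_functionD)
  have "AE y in N. \<forall>v\<in>X ` space M. emeasure (\<kappa> y) (T g -` (X -` {v} \<inter> space M) \<inter> space M) =
      emeasure (\<kappa> (S g y)) (X -` {v} \<inter> space M)"
    using fin g X by (intro AE_finite_allI \<kappa>_equivariant) (auto dest: simple_functionD)
  then show ?thesis
  proof (rule AE_mp, intro AE_I2 impI)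
    fix y assume y: "y \<in> space N"
      and eq: "\<forall>v\<in>X ` space M. emeasure (\<kappa> y) (T g -` (X -` {v} \<inter> space M) \<inter> space M) =
        emeasure (\<kappa> (S g y)) (X -` {v} \<inter> space M)"
    have "(\<lambda>x. X (T g x)) -` {v} \<inter> space M = T g -` (X -` {v} \<inter> space M) \<inter> space M" for v
      using T_space[OF g] by auto
    then have "fent (\<kappa> y) (\<lambda>x. X (T g x)) =
        (\<Sum>v\<in>X ` space M. eta (measure (\<kappa> y) (T g -` (X -` {v} \<inter> space M) \<inter> space M)))"
      using fin T_space[OF g] by (subst fent_superset[of "X ` space M"]) (auto simp: space_\<kappa>[OF y])
    also have "\<dots> = (\<Sum>v\<in>X ` space M. eta (measure (\<kappa> (S g y)) (X -` {v} \<inter> space M)))"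
      using eq by (intro sum.cong) (auto simp: measure_def)
    also have "\<dots> = fent (\<kappa> (S g y)) X"
      by (simp add: fent_def space_\<kappa>[OF S_space[OF g y]])
    finally show "fent (\<kappa> y) (\<lambda>x. X (T g x)) = fent (\<kappa> (S g y)) X" .
  qed
qed

lemma fcent_equivariant:
  assumes "simple_function M X" "simple_function M Y" "g \<in> carrier G"
  shows "AE y in N. fcent (\<kappa> y) (\<lambda>x. X (T g x)) (\<lambda>x. Y (T g x)) = fcent (\<kappa> (S g y)) X Y"
  using fent_equivariant[OF simple_function_Pair[OF assms(1,2)] assms(3)]
    fent_equivariant[OF assms(2,3)]
  by eventually_elim (simp add: fcent_def)

lemma measurable_fent:
  assumes X: "simple_function M X"
  shows "(\<lambda>y. fent (\<kappa> y) X) \<in> borel_measurable N"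
proof -
  have "(\<lambda>y. \<Sum>v\<in>X ` space M. eta (measure (\<kappa> y) (X -` {v} \<inter> space M))) \<in> borel_measurable N"
  proof (rule borel_measurable_sum)
    fix v
    have "X -` {v} \<inter> space M \<in> sets M" using X by (rule simple_functionD)
    then show "(\<lambda>y. eta (measure (\<kappa> y) (X -` {v} \<inter> space M))) \<in> borel_measurable N"
      unfolding eta_def by measurable
  qed
  also have "?this \<longleftrightarrow> ?thesis"
    by (rule measurable_cong) (simp add: fent_def space_\<kappa>)
  finally show ?thesis .
qed

lemma measurable_fcent:
  assumes "simple_function M X" "simple_function M Y"
  shows "(\<lambda>y. fcent (\<kappa> y) X Y) \<in> borel_measurable N"
  unfolding fcent_def using assms by (intro borel_measurable_diff measurable_fent) auto

section \<open>Itineraries and joins of translates\<close>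

text \<open>\<open>itin D\<close> labels the atoms of the join over \<open>D\<close>. Unlike \<open>join_partition\<close>, which is \<open>{UNIV}\<close>
  for \<open>D = {}\<close>, it also behaves well for the empty set, where it is constant.\<close>

definition itin :: "'a set \<Rightarrow> 'x \<Rightarrow> 'a \<Rightarrow> 'x set" where
  "itin D x = (\<lambda>g\<in>D. cell P (T g x))"

lemma itin_eq_iff: "itin D x = itin D y \<longleftrightarrow> (\<forall>g\<in>D. cell P (T g x) = cell P (T g y))"
  by (auto simp: itin_def fun_eq_iff restrict_def)

lemma translate_eq_iff:
  assumes "g \<in> carrier G"
  shows partition_on_translate: "partition_on (space M) (translate_partition M T P g)"
    and "x \<in> space M \<Longrightarrow> y \<in> space M \<Longrightarrow> cell (translate_partition M T P g) x =
      cell (translate_partition M T P g) y \<longleftrightarrow> cell P (T g x) = cell P (T g y)"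
proof -
  \<comment> \<open>Surjectivity keeps the preimages of cells nonempty, as a partition
    requires.\<close>
  have img: "\<exists>x\<in>space M. T g x = z" if "z \<in> space M" for z
    using T.surj_prop[OF assms] that by (metis imageE)
  show part: "partition_on (space M) (translate_partition M T P g)"
  proof (rule partition_onI)
    show "\<Union> (translate_partition M T P g) = space M"
    proof (intro equalityI subsetI)
      fix x assume x: "x \<in> space M"
      then show "x \<in> \<Union> (translate_partition M T P g)"
        using cell_in[OF partition_P T_space[OF assms x]] in_cell[OF partition_P T_space[OF assms x]]
        by (auto simp: translate_partition_def)
    qed (auto simp: translate_partition_def)
    show "disjnt p q" if pq: "p \<in> translate_partition M T P g" "q \<in> translate_partition M T P g" "p \<noteq> q"
      for p q
    proof -
      obtain A B where AB: "A \<in> P" "B \<in> P" "p = T g -` A \<inter> space M" "q = T g -` B \<inter> space M"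
        using pq by (auto simp: translate_partition_def)
      with pq(3) have "A \<inter> B = {}" using disjointD[OF partition_onD2[OF partition_P]] by blast
      with AB show ?thesis by (auto simp: disjnt_def)
    qed
    show "{} \<notin> translate_partition M T P g"
    proof
      assume "{} \<in> translate_partition M T P g"
      then obtain A where A: "A \<in> P" "T g -` A \<inter> space M = {}"
        by (auto simp: translate_partition_def)
      moreover obtain z where "z \<in> A" using A(1) partition_onD3[OF partition_P] by (metis ex_in_conv)
      moreover from this A(1) have "z \<in> space M" using partition_onD1[OF partition_P] by auto
      ultimately show False using img[of z] by blast
    qed
  qed
  have "cell (translate_partition M T P g) x = T g -` cell P (T g x) \<inter> space M"
    if "x \<in> space M" for x
    using cell_in[OF partition_P T_space[OF assms that]] in_cell[OF partition_P T_space[OF assms that]] that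
    by (intro cell_eq[OF part]) (auto simp: translate_partition_def)
  moreover have "cell P (T g x) = cell P (T g y)"
    if "x \<in> space M" "y \<in> space M" "T g -` cell P (T g x) \<inter> space M = T g -` cell P (T g y) \<inter> space M"
    for x y
  proof -
    have "T g y \<in> cell P (T g x)"
      using that in_cell[OF partition_P T_space[OF assms that(2)]] by blast
    then show ?thesis
      using cell_eq[OF partition_P cell_in[OF partition_P T_space[OF assms that(1)]]] by simp
  qed
  ultimately show "cell (translate_partition M T P g) x = cell (translate_partition M T P g) y \<longleftrightarrow>
    cell P (T g x) = cell P (T g y)" if "x \<in> space M" "y \<in> space M"
    using that by (intro iffI) (metis, simp)
qed

lemma
  assumes D: "D \<subseteq> carrier G" "D \<noteq> {}"
  shows partition_on_join: "partition_on (space M) (join_partition M T P D)"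
    and cell_join_eq_iff: "x \<in> space M \<Longrightarrow> y \<in> space M \<Longrightarrow>
      cell (join_partition M T P D) x = cell (join_partition M T P D) y \<longleftrightarrow> itin D x = itin D y"
proof -
  have Q: "\<And>Q. Q \<in> translate_partition M T P ` D \<Longrightarrow> partition_on (space M) Q"
    "translate_partition M T P ` D \<noteq> {}"
    using D partition_on_translate by auto
  show "partition_on (space M) (join_partition M T P D)"
    unfolding join_partition_def by (rule partition_on_common_refinement[OF Q])
  show "cell (join_partition M T P D) x = cell (join_partition M T P D) y \<longleftrightarrow> itin D x = itin D y"
    if "x \<in> space M" "y \<in> space M"
  proof -
    have "cell (join_partition M T P D) x = cell (join_partition M T P D) y \<longleftrightarrow>
        (\<forall>Q\<in>translate_partition M T P ` D. cell Q x = cell Q y)"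
      unfolding join_partition_def by (rule cell_common_refinement_eq_iff[OF Q that])
    also have "\<dots> \<longleftrightarrow> (\<forall>g\<in>D. cell P (T g x) = cell P (T g y))"
      unfolding Set.ball_simps(9) using D(1) by (intro ball_cong refl translate_eq_iff(2) that) blast
    finally show ?thesis by (simp only: itin_eq_iff)
  qed
qed

lemma translate_sets: "g \<in> carrier G \<Longrightarrow> translate_partition M T P g \<subseteq> sets M"
  using P_sets measurable_sets[OF measurable_T] by (auto simp: translate_partition_def)

lemma measurable_partition_join:
  assumes "D \<subseteq> carrier G" "D \<noteq> {}" "finite D"
  shows "measurable_partition M (sets M) (join_partition M T P D)"
proof -
  have "finite (join_partition M T P D)"
    unfolding join_partition_def
    using assms finite_P by (intro finite_common_refinement) (auto simp: translate_partition_def)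
  moreover have "join_partition M T P D \<subseteq> sets M"
  proof
    fix A assume "A \<in> join_partition M T P D"
    then obtain f where f: "f \<in> (\<Pi> Q\<in>translate_partition M T P ` D. Q)"
      "A = \<Inter> (f ` (translate_partition M T P ` D))"
      by (auto simp: join_partition_def common_refinement)
    have "f Q \<in> sets M" if "Q \<in> translate_partition M T P ` D" for Q
      using f(1) that assms(1) translate_sets by (auto simp: Pi_iff)
    then show "A \<in> sets M" unfolding f(2) using assms by (intro sets.finite_INT) auto
  qed
  ultimately show ?thesis
    using partition_on_join[OF assms(1,2)] by (simp add: measurable_partition_def)
qed

section \<open>Cylinder sets\<close>

text \<open>These are unions of atoms of a join over a finite part \<open>K\<close> of
  \<open>D\<close>, so each depends on finitely many group elements even when \<open>D\<close> is
  infinite. The one-sided implication is required for all ordered pairs and hence amounts to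
  invariance.\<close>

definition join_algebra :: "'a set \<Rightarrow> 'x set set" where
  "join_algebra D = {A. A \<subseteq> space M \<and> (\<exists>K. finite K \<and> K \<subseteq> D \<and>
     (\<forall>x\<in>space M. \<forall>y\<in>space M. itin K x = itin K y \<longrightarrow> x \<in> A \<longrightarrow> y \<in> A))}"

lemma join_algebraI:
  assumes "A \<subseteq> space M" "finite K" "K \<subseteq> D"
    and "\<And>x y. x \<in> space M \<Longrightarrow> y \<in> space M \<Longrightarrow> itin K x = itin K y \<Longrightarrow> x \<in> A \<Longrightarrow> y \<in> A"
  shows "A \<in> join_algebra D"
  unfolding join_algebra_def using assms by (intro CollectI conjI exI[of _ K] ballI impI)

lemma join_algebraE:
  assumes "A \<in> join_algebra D"
  obtains K where "A \<subseteq> space M" "finite K" "K \<subseteq> D"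
    "\<forall>x\<in>space M. \<forall>y\<in>space M. itin K x = itin K y \<longrightarrow> (x \<in> A \<longleftrightarrow> y \<in> A)"
proof -
  from assms obtain K where K: "A \<subseteq> space M" "finite K" "K \<subseteq> D"
    "\<forall>x\<in>space M. \<forall>y\<in>space M. itin K x = itin K y \<longrightarrow> x \<in> A \<longrightarrow> y \<in> A"
    unfolding join_algebra_def by blast
  show thesis
    by (rule that[OF K(1-3)]) (use K(4) in metis)
qed

lemma algebra_join_algebra: "algebra (space M) (join_algebra D)"
  unfolding algebra_iff_Un
proof (intro conjI ballI)
  show "join_algebra D \<subseteq> Pow (space M)" by (auto elim: join_algebraE)
  show "{} \<in> join_algebra D" by (rule join_algebraI[of _ "{}"]) auto
next
  fix A assume "A \<in> join_algebra D"
  then obtain K where K: "A \<subseteq> space M" "finite K" "K \<subseteq> D"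
    "\<forall>x\<in>space M. \<forall>y\<in>space M. itin K x = itin K y \<longrightarrow> (x \<in> A \<longleftrightarrow> y \<in> A)"
    by (rule join_algebraE)
  show "space M - A \<in> join_algebra D"
    by (rule join_algebraI[OF _ K(2,3)]) (use K(4) in blast)+
next
  fix A B assume "A \<in> join_algebra D" "B \<in> join_algebra D"
  from this(1) obtain K where K: "A \<subseteq> space M" "finite K" "K \<subseteq> D"
    "\<forall>x\<in>space M. \<forall>y\<in>space M. itin K x = itin K y \<longrightarrow> (x \<in> A \<longleftrightarrow> y \<in> A)"
    by (rule join_algebraE)
  from \<open>B \<in> join_algebra D\<close> obtain K' where K': "B \<subseteq> space M" "finite K'" "K' \<subseteq> D"
    "\<forall>x\<in>space M. \<forall>y\<in>space M. itin K' x = itin K' y \<longrightarrow> (x \<in> B \<longleftrightarrow> y \<in> B)"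
    by (rule join_algebraE)
  show "A \<union> B \<in> join_algebra D"
  proof (rule join_algebraI[of _ "K \<union> K'"])
    fix x y assume xy: "x \<in> space M" "y \<in> space M" "x \<in> A \<union> B"
      and "itin (K \<union> K') x = itin (K \<union> K') y"
    then have "itin K x = itin K y" "itin K' x = itin K' y" unfolding itin_eq_iff by blast+
    then show "y \<in> A \<union> B" using K(4)[rule_format, OF xy(1,2)] K'(4)[rule_format, OF xy(1,2)] xy(3) by blast
  qed (use K K' in auto)
qed

lemma join_sigma_subset: "D \<subseteq> carrier G \<Longrightarrow> join_sigma M T P D \<subseteq> sets M"
  unfolding join_sigma_def using translate_sets by (intro sets.sigma_sets_subset) blast

text \<open>Packs \<open>join_sigma\<close> as a measure space, the form in which
  \<open>subalgebra\<close> and \<open>simple_function\<close> take a sigma-algebra.\<close>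

definition join_space :: "'a set \<Rightarrow> 'x measure" where
  "join_space D = sigma (space M) (\<Union>g\<in>D. translate_partition M T P g)"

lemma
  shows space_join_space: "space (join_space D) = space M"
    and sets_join_space: "sets (join_space D) = join_sigma M T P D"
proof -
  have "(\<Union>g\<in>D. translate_partition M T P g) \<subseteq> Pow (space M)"
    by (auto simp: translate_partition_def)
  then show "space (join_space D) = space M" "sets (join_space D) = join_sigma M T P D"
    by (simp_all add: join_space_def join_sigma_def)
qed

lemma simple_itin_join:
  assumes D: "D \<subseteq> carrier G" and K: "finite K" "K \<subseteq> D"
  shows "simple_function (join_space D) (itin K)"
  unfolding simple_function_def space_join_space
proof (intro conjI ballI)
  have "itin K ` space M \<subseteq> PiE K (\<lambda>_. P)"
    using K D cell_in[OF partition_P T_space] by (auto simp: itin_def)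
  then show "finite (itin K ` space M)" by (rule finite_subset) (simp add: K finite_P finite_PiE)
  fix v assume "v \<in> itin K ` space M"
  then obtain z where z: "z \<in> space M" "v = itin K z" by auto
  have "itin K -` {v} \<inter> space M = {x \<in> space (join_space D). \<forall>g\<in>K. cell P (T g x) = cell P (T g z)}"
    by (auto simp: z itin_eq_iff space_join_space)
  also have "\<dots> \<in> sets (join_space D)"
  proof (rule sets.sets_Collect_finite_All[OF _ K(1)])
    fix g assume g: "g \<in> K"
    then have gc: "g \<in> carrier G" using K D by auto
    have "{x \<in> space (join_space D). cell P (T g x) = cell P (T g z)} =
        T g -` cell P (T g z) \<inter> space M"
      using cell_eq[OF partition_P cell_in[OF partition_P T_space[OF gc z(1)]]]
        in_cell[OF partition_P T_space[OF gc]]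
      by (auto simp: space_join_space)
    also have "\<dots> \<in> translate_partition M T P g"
      using cell_in[OF partition_P T_space[OF gc z(1)]] by (auto simp: translate_partition_def)
    finally show "{x \<in> space (join_space D). cell P (T g x) = cell P (T g z)} \<in> sets (join_space D)"
      using g K by (auto simp: sets_join_space join_sigma_def)
  qed
  finally show "itin K -` {v} \<inter> space M \<in> sets (join_space D)" .
qed

lemma simple_itin:
  assumes "finite K" "K \<subseteq> carrier G"
  shows "simple_function M (itin K)"
  by (rule simple_function_subalgebra[OF simple_itin_join[OF assms(2,1) order_refl]])
    (use join_sigma_subset[OF assms(2)] in \<open>auto simp: space_join_space sets_join_space\<close>)

lemma simple_cell: "simple_function M (cell P)"
  by (rule simple_function_cell[OF partition refl])

text \<open>A generator is a cylinder over a single group element; conversely a cylinder over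
  \<open>K\<close> is the preimage of a set of labels under \<open>itin K\<close>, which has finite
  range.\<close>

lemma sigma_sets_join_algebra:
  assumes D: "D \<subseteq> carrier G"
  shows "join_sigma M T P D = sigma_sets (space M) (join_algebra D)"
proof
  show "join_sigma M T P D \<subseteq> sigma_sets (space M) (join_algebra D)"
    unfolding join_sigma_def
  proof (rule sigma_sets_mono', intro subsetI)
    fix A assume "A \<in> (\<Union>g\<in>D. translate_partition M T P g)"
    then obtain g B where g: "g \<in> D" "B \<in> P" "A = T g -` B \<inter> space M"
      by (auto simp: translate_partition_def)
    have gc: "g \<in> carrier G" using g D by auto
    have "y \<in> A" if "x \<in> A" "y \<in> space M" "cell P (T g x) = cell P (T g y)" for x y
    proof -
      have "cell P (T g x) = B" using cell_eq[OF partition_P g(2)] that(1) g(3) by auto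
      then show ?thesis using in_cell[OF partition_P T_space[OF gc that(2)]] that g(3) by auto
    qed
    then show "A \<in> join_algebra D"
      using g by (intro join_algebraI[of _ "{g}"]) (simp_all add: itin_eq_iff)
  qed
  show "sigma_sets (space M) (join_algebra D) \<subseteq> join_sigma M T P D"
    unfolding sets_join_space[symmetric] space_join_space[of D, symmetric]
  proof (rule sets.sigma_sets_subset, rule subsetI)
    fix A assume "A \<in> join_algebra D"
    then obtain K where K: "A \<subseteq> space M" "finite K" "K \<subseteq> D"
      "\<forall>x\<in>space M. \<forall>y\<in>space M. itin K x = itin K y \<longrightarrow> (x \<in> A \<longleftrightarrow> y \<in> A)"
      by (rule join_algebraE)
    have "A = itin K -` (itin K ` A) \<inter> space (join_space D)"
      unfolding space_join_space
    proof (intro equalityI subsetI)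
      fix x assume "x \<in> itin K -` (itin K ` A) \<inter> space M"
      then obtain z where "z \<in> A" "itin K x = itin K z" "x \<in> space M" by auto
      then show "x \<in> A" using K(4)[rule_format, of x z] K(1) by blast
    qed (use K(1) in auto)
    also have "\<dots> \<in> sets (join_space D)"
      using simple_itin_join[OF D K(2,3)] by (rule simple_functionD)
    finally show "A \<in> sets (join_space D)" .
  qed
qed

lemma subalgebra_join:
  "D \<subseteq> carrier G \<Longrightarrow> y \<in> space N \<Longrightarrow> subalgebra (\<kappa> y) (join_space D)"
  using join_sigma_subset[of D]
  by (simp add: subalgebra_def space_join_space sets_join_space space_\<kappa> sets_\<kappa>)

end

lemma strict_linear_order_max:
  assumes "strict_linear_order_on A r" "finite F" "F \<subseteq> A" "F \<noteq> {}"
  obtains m where "m \<in> F" "\<And>h. h \<in> F \<Longrightarrow> h \<noteq> m \<Longrightarrow> (h, m) \<in> r"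
proof -
  have "transp_on F (\<lambda>a b. (a, b) \<in> r)" "totalp_on F (\<lambda>a b. (a, b) \<in> r)"
    using assms unfolding strict_linear_order_on_def
    by (auto simp: transp_on_def totalp_on_def total_on_def dest: transD)
  from Finite_Set.bex_greatest_element[OF assms(2,4) this] show thesis
    using that by blast
qed

context ordered_factor
begin

section \<open>Entropy given the past of the unit\<close>

definition past :: "'y \<Rightarrow> 'a set" where
  "past y = {h \<in> carrier G. (h, \<one>) \<in> L y}"

text \<open>Cutting \<open>D\<close> down to the past lets one fixed finite \<open>D\<close> serve
  all \<open>y\<close>, and \<open>D\<close> may grow through the whole group.\<close>

definition finite_rate :: "'y \<Rightarrow> 'a set \<Rightarrow> real" where
  "finite_rate y D = fcent (\<kappa> y) (cell P) (itin (D \<inter> past y))"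

definition rate :: "'y \<Rightarrow> real" where
  "rate y = cond_part_entropy (\<kappa> y) P (join_sigma M T P (past y))"

lemma past_subset: "past y \<subseteq> carrier G"
  by (auto simp: past_def)

lemma simple_itin_past: "finite D \<Longrightarrow> simple_function M (itin (D \<inter> past y))"
  using past_subset by (intro simple_itin) auto

lemma rate_le:
  assumes y: "y \<in> space N" and D: "finite D"
  shows "rate y \<le> finite_rate y D"
proof -
  interpret K: prob_space "\<kappa> y" using y by (rule prob_space_\<kappa>)
  show ?thesis
    unfolding rate_def finite_rate_def sets_join_space[symmetric]
    using D past_subset
    by (intro K.cond_part_entropy_le subalgebra_join partition_\<kappa> y simple_itin_join) auto
qed

lemma finite_rate_antimono:
  assumes y: "y \<in> space N" and D: "D \<subseteq> D'" "finite D'"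
  shows "finite_rate y D' \<le> finite_rate y D"
proof -
  interpret K: prob_space "\<kappa> y" using y by (rule prob_space_\<kappa>)
  have "finite D" using D by (rule finite_subset)
  then show ?thesis
    unfolding finite_rate_def using D
    by (intro K.fcent_antimono_factor simple_\<kappa> y simple_cell simple_itin_past)
      (auto simp: itin_eq_iff)
qed

text \<open>The upper bound is uniform in \<open>y\<close> and \<open>D\<close>: it dominates in the
  limit over \<open>D\<close> and covers the exceptional elements of a Folner set.\<close>

lemma finite_rate_bounds:
  assumes y: "y \<in> space N" and D: "finite D"
  shows "0 \<le> finite_rate y D" "finite_rate y D \<le> real (card P)"
proof -
  interpret K: prob_space "\<kappa> y" using y by (rule prob_space_\<kappa>)
  note simple = simple_\<kappa>[OF y simple_cell] simple_\<kappa>[OF y simple_itin_past[OF D, of y]]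
  show "0 \<le> finite_rate y D" unfolding finite_rate_def using simple by (rule K.fcent_nonneg)
  show "finite_rate y D \<le> real (card P)"
    unfolding finite_rate_def using K.fcent_le_card[OF simple]
    by (simp add: space_\<kappa>[OF y] cell_image[OF partition_P])
qed

text \<open>A good approximation of the past uses finitely many cylinder sets, each depending on
  finitely many elements. Collected in \<open>K\<close>, these give an itinerary finer than all the
  memberships.\<close>

lemma rate_approx:
  assumes y: "y \<in> space N" and e: "e > 0"
  obtains K where "finite K" "K \<subseteq> carrier G" "finite_rate y K < rate y + e"
proof -
  interpret K: prob_space "\<kappa> y" using y by (rule prob_space_\<kappa>)
  have alg: "algebra (space (\<kappa> y)) (join_algebra (past y))"
    unfolding space_\<kappa>[OF y] by (rule algebra_join_algebra)
  have gen: "sets (join_space (past y)) = sigma_sets (space (\<kappa> y)) (join_algebra (past y))"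
    unfolding sets_join_space space_\<kappa>[OF y] by (rule sigma_sets_join_algebra[OF past_subset])
  obtain \<E> where \<E>: "finite \<E>" "\<E> \<subseteq> join_algebra (past y)"
    "fcent (\<kappa> y) (cell P) (\<lambda>x. {E \<in> \<E>. x \<in> E}) < rate y + e"
    using K.cond_part_entropy_approx_algebra[OF subalgebra_join[OF past_subset y] partition_\<kappa>[OF y] alg gen e]
    unfolding rate_def sets_join_space by blast
  have \<E>M: "E \<in> sets (\<kappa> y)" if "E \<in> \<E>" for E
    using that \<E>(2) join_sigma_subset[OF past_subset]
    unfolding sets_\<kappa>[OF y] sigma_sets_join_algebra[OF past_subset]
    by (meson sigma_sets.Basic subsetD)
  have "\<forall>E\<in>\<E>. \<exists>K. finite K \<and> K \<subseteq> past y \<and>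
      (\<forall>x\<in>space M. \<forall>z\<in>space M. itin K x = itin K z \<longrightarrow> (x \<in> E \<longleftrightarrow> z \<in> E))"
  proof
    fix E assume "E \<in> \<E>"
    then have "E \<in> join_algebra (past y)" using \<E>(2) by auto
    then show "\<exists>K. finite K \<and> K \<subseteq> past y \<and>
      (\<forall>x\<in>space M. \<forall>z\<in>space M. itin K x = itin K z \<longrightarrow> (x \<in> E \<longleftrightarrow> z \<in> E))"
      by (rule join_algebraE) blast
  qed
  from bchoice[OF this] obtain k where k: "\<forall>E\<in>\<E>. finite (k E) \<and> k E \<subseteq> past y \<and>
      (\<forall>x\<in>space M. \<forall>z\<in>space M. itin (k E) x = itin (k E) z \<longrightarrow> (x \<in> E \<longleftrightarrow> z \<in> E))" ..
  define K where "K = (\<Union>E\<in>\<E>. k E)"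
  have K: "finite K" "K \<subseteq> past y" unfolding K_def using k \<E>(1) by auto
  have "finite_rate y K \<le> fcent (\<kappa> y) (cell P) (\<lambda>x. {E \<in> \<E>. x \<in> E})"
    unfolding finite_rate_def
  proof (rule K.fcent_antimono_factor)
    show "simple_function (\<kappa> y) (\<lambda>x. {E \<in> \<E>. x \<in> E})"
      using \<E>(1) \<E>M by (rule simple_function_membership)
    fix x z assume xz: "x \<in> space (\<kappa> y)" "z \<in> space (\<kappa> y)" "itin (K \<inter> past y) x = itin (K \<inter> past y) z"
    have "x \<in> E \<longleftrightarrow> z \<in> E" if E: "E \<in> \<E>" for E
    proof -
      have "itin (k E) x = itin (k E) z"
        using xz(3) K(2) E unfolding itin_eq_iff K_def by blast
      then show ?thesis using k E xz(1,2) space_\<kappa>[OF y] by blast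
    qed
    then show "{E \<in> \<E>. x \<in> E} = {E \<in> \<E>. z \<in> E}" by auto
  qed (intro simple_\<kappa>[OF y] simple_cell simple_itin_past K(1))+
  then show thesis using \<E>(3) K past_subset[of y] by (intro that[of K]) auto
qed

text \<open>The conditioning set varies with \<open>y\<close> but takes finitely many values, each
  on a measurable set of \<open>y\<close>; for a fixed value the entropy is measurable in the
  kernel.\<close>

lemma measurable_finite_rate:
  assumes D: "finite D" "D \<subseteq> carrier G"
  shows "(\<lambda>y. finite_rate y D) \<in> borel_measurable N"
  unfolding finite_rate_def
proof (rule measurable_compose_countable'[where I = "Pow D" and g = "\<lambda>y. D \<inter> past y"])
  show "(\<lambda>y. fcent (\<kappa> y) (cell P) (itin K)) \<in> borel_measurable N" if "K \<in> Pow D" for K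
    using that D by (intro measurable_fcent simple_cell simple_itin) (auto intro: finite_subset)
  show "(\<lambda>y. D \<inter> past y) \<in> N \<rightarrow>\<^sub>M count_space (Pow D)"
    unfolding measurable_count_space_eq2[OF finite_Pow_iff[THEN iffD2, OF D(1)]]
  proof (intro conjI ballI)
    fix K assume "K \<in> Pow D"
    then have "(\<lambda>y. D \<inter> past y) -` {K} \<inter> space N = {y \<in> space N. \<forall>h\<in>D. (h, \<one>) \<in> L y \<longleftrightarrow> h \<in> K}"
      using D by (auto simp: past_def)
    also have "\<dots> \<in> sets N"
    proof (rule sets.sets_Collect_finite_All[OF _ D(1)])
      fix h assume "h \<in> D"
      then have "{y \<in> space N. (h, \<one>) \<in> L y} \<in> sets N" using D by (intro measurable_order) auto
      then show "{y \<in> space N. (h, \<one>) \<in> L y \<longleftrightarrow> h \<in> K} \<in> sets N"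
        by (cases "h \<in> K") (auto intro: sets.sets_Collect_neg)
    qed
    finally show "(\<lambda>y. D \<inter> past y) -` {K} \<inter> space N \<in> sets N" .
  qed auto
  show "countable (Pow D)" using D by (simp add: countable_finite)
qed

lemma integrable_finite_rate:
  assumes "finite D" "D \<subseteq> carrier G"
  shows "integrable N (\<lambda>y. finite_rate y D)"
  using finite_rate_bounds[OF _ assms(1)]
  by (intro N.integrable_const_bound[of _ "real (card P)"] measurable_finite_rate assms)
    (auto intro!: AE_I2)

definition exhaust :: "nat \<Rightarrow> 'a set" where
  "exhaust n = from_nat_into (carrier G) ` {..<n}"

lemma exhaust: "finite (exhaust n)" "exhaust n \<subseteq> carrier G"
  unfolding exhaust_def using from_nat_into[of "carrier G"] by auto

text \<open>The finite set that is good enough depends on \<open>y\<close>, but it lies in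
  \<open>exhaust n\<close> for all large \<open>n\<close>, and \<open>finite_rate\<close> decreases
  as its set grows.\<close>

lemma finite_rate_tendsto:
  assumes y: "y \<in> space N"
  shows "(\<lambda>n. finite_rate y (exhaust n)) \<longlonglongrightarrow> rate y"
proof (rule LIMSEQ_I)
  fix e :: real assume "e > 0"
  with y obtain K where K: "finite K" "K \<subseteq> carrier G" "finite_rate y K < rate y + e"
    by (rule rate_approx)
  obtain n where n: "to_nat_on (carrier G) ` K \<subseteq> {..<n}"
    using finite_nat_iff_bounded K(1) by blast
  have "K \<subseteq> exhaust m" if "m \<ge> n" for m
  proof
    fix k assume k: "k \<in> K"
    then have "k = from_nat_into (carrier G) (to_nat_on (carrier G) k)"
      using K(2) countable_carrier by auto
    then show "k \<in> exhaust m" unfolding exhaust_def using n k that by (intro image_eqI) auto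
  qed
  then have "finite_rate y (exhaust m) \<le> finite_rate y K" if "m \<ge> n" for m
    using that by (intro finite_rate_antimono y exhaust) auto
  then show "\<exists>n0. \<forall>n\<ge>n0. norm (finite_rate y (exhaust n) - rate y) < e"
    using K(3) rate_le[OF y exhaust(1)] by (intro exI[of _ n]) fastforce
qed

text \<open>The infimum defining \<open>rate\<close> ranges over partitions that depend on
  \<open>y\<close>, so measurability is drawn from the pointwise limit; the bound
  \<open>card P\<close> lets this limit pass through the integral.\<close>

lemma
  shows integrable_rate: "integrable N rate"
    and integral_finite_rate_tendsto:
      "(\<lambda>n. \<integral>y. finite_rate y (exhaust n) \<partial>N) \<longlonglongrightarrow> (\<integral>y. rate y \<partial>N)"
proof -
  have meas: "rate \<in> borel_measurable N"
    by (intro borel_measurable_LIMSEQ_real[OF finite_rate_tendsto] measurable_finite_rate[OF exhaust])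
  have bound: "AE y in N. norm (finite_rate y (exhaust n)) \<le> real (card P)" for n
    using finite_rate_bounds[OF _ exhaust(1)] by (intro AE_I2) auto
  have lim: "AE y in N. (\<lambda>n. finite_rate y (exhaust n)) \<longlonglongrightarrow> rate y"
    by (intro AE_I2 finite_rate_tendsto)
  show "integrable N rate"
    by (rule integrable_dominated_convergence[OF meas _ _ lim bound])
      (auto intro!: measurable_finite_rate exhaust(1) exhaust(2))
  show "(\<lambda>n. \<integral>y. finite_rate y (exhaust n) \<partial>N) \<longlonglongrightarrow> (\<integral>y. rate y \<partial>N)"
    by (rule integral_dominated_convergence[OF meas _ _ lim bound])
      (auto intro!: measurable_finite_rate exhaust(1) exhaust(2))
qed

section \<open>Chain rule along the order\<close>

text \<open>Induction by removing the greatest element \<open>m\<close> of \<open>F\<close>. All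
  others precede it, so its summand is the entropy of \<open>itin F\<close> minus that of the rest;
  it precedes none of them, so their conditioning sets do not change.\<close>

lemma chain_rule:
  assumes y: "y \<in> space N" and F: "finite F" "F \<subseteq> carrier G"
  shows "fent (\<kappa> y) (itin F) =
    (\<Sum>g\<in>F. fcent (\<kappa> y) (\<lambda>x. cell P (T g x)) (itin {h \<in> F. (h, g) \<in> L y}))"
  using F
proof (induction "card F" arbitrary: F)
  case 0
  interpret K: prob_space "\<kappa> y" using y by (rule prob_space_\<kappa>)
  have "F = {}" using 0 by simp
  moreover have "itin {} = (\<lambda>_ _. undefined)" by (auto simp: itin_def fun_eq_iff)
  ultimately show ?case by (simp add: K.fent_const)
next
  case (Suc n)
  have "F \<noteq> {}" using Suc(2) by auto
  with linear[OF y] Suc(3,4) obtain m where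
    m: "m \<in> F" "\<And>h. h \<in> F \<Longrightarrow> h \<noteq> m \<Longrightarrow> (h, m) \<in> L y"
    using strict_linear_order_max by metis
  have irr: "(m, h) \<notin> L y" if "h \<in> F" for h
    using linear[OF y] m(2)[OF that] unfolding strict_linear_order_on_def
    by (metis irrefl_def transD)
  define F' where "F' = F - {m}"
  have F: "F = insert m F'" "m \<notin> F'" "finite F'" using m Suc(3) by (auto simp: F'_def)
  have "fent (\<kappa> y) (itin F') =
      (\<Sum>g\<in>F'. fcent (\<kappa> y) (\<lambda>x. cell P (T g x)) (itin {h \<in> F'. (h, g) \<in> L y}))"
    using Suc(2,3,4) m(1) by (intro Suc(1)) (auto simp: F'_def)
  also have "\<dots> = (\<Sum>g\<in>F'. fcent (\<kappa> y) (\<lambda>x. cell P (T g x)) (itin {h \<in> F. (h, g) \<in> L y}))"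
  proof (rule sum.cong[OF refl])
    fix g assume "g \<in> F'"
    then have "{h \<in> F'. (h, g) \<in> L y} = {h \<in> F. (h, g) \<in> L y}"
      using irr[of g] by (auto simp: F'_def)
    then show "fcent (\<kappa> y) (\<lambda>x. cell P (T g x)) (itin {h \<in> F'. (h, g) \<in> L y}) =
        fcent (\<kappa> y) (\<lambda>x. cell P (T g x)) (itin {h \<in> F. (h, g) \<in> L y})" by simp
  qed
  finally have *: "fent (\<kappa> y) (itin F') = \<dots>" .
  have "{h \<in> F. (h, m) \<in> L y} = F'" using m irr[of m] by (auto simp: F'_def)
  then have "fcent (\<kappa> y) (\<lambda>x. cell P (T m x)) (itin {h \<in> F. (h, m) \<in> L y}) =
      fent (\<kappa> y) (\<lambda>x. (cell P (T m x), itin F' x)) - fent (\<kappa> y) (itin F')"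
    by (simp add: fcent_def)
  also have "fent (\<kappa> y) (\<lambda>x. (cell P (T m x), itin F' x)) = fent (\<kappa> y) (itin F)"
    by (rule fent_kernel) (auto simp: itin_eq_iff F(1))
  finally show ?case using * F by simp
qed

text \<open>Right translation by \<open>inv g\<close> moves \<open>g\<close> to the unit and the
  elements of \<open>F\<close> before \<open>g\<close> into \<open>past (S g y)\<close>. As
  \<open>T (u \<otimes> g)\<close> is \<open>T u\<close> after \<open>T g\<close>, the itinerary of
  \<open>x\<close> before \<open>g\<close> becomes an itinerary of \<open>T g x\<close>.\<close>

lemma fcent_translate:
  assumes F: "finite F" "F \<subseteq> carrier G" and g: "g \<in> carrier G"
  shows "AE y in N. fcent (\<kappa> y) (\<lambda>x. cell P (T g x)) (itin {h \<in> F. (h, g) \<in> L y}) =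
    finite_rate (S g y) ((\<lambda>h. h \<otimes> inv g) ` F)"
proof -
  let ?D = "(\<lambda>h. h \<otimes> inv g) ` F"
  have D: "finite ?D" "?D \<subseteq> carrier G" using F g by auto
  \<comment> \<open>The conditioning set varies with \<open>y\<close>, so equivariance is first
    secured outside one null set for all subsets of the finite set \<open>?D\<close>.\<close>
  have "AE y in N. \<forall>K\<in>Pow ?D. fcent (\<kappa> y) (\<lambda>x. cell P (T g x)) (\<lambda>x. itin K (T g x)) =
      fcent (\<kappa> (S g y)) (cell P) (itin K)"
    using D g finite_subset[OF _ D(1)]
    by (intro AE_finite_allI fcent_equivariant simple_cell simple_itin) auto
  then show ?thesis
  proof (rule AE_mp, intro AE_I2 impI)
    fix y assume y: "y \<in> space N" and
      eq: "\<forall>K\<in>Pow ?D. fcent (\<kappa> y) (\<lambda>x. cell P (T g x)) (\<lambda>x. itin K (T g x)) =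
        fcent (\<kappa> (S g y)) (cell P) (itin K)"
    let ?K = "?D \<inter> past (S g y)"
    have K: "(\<lambda>u. u \<otimes> g) ` ?K = {h \<in> F. (h, g) \<in> L y}"
    proof (intro equalityI subsetI)
      fix h assume "h \<in> (\<lambda>u. u \<otimes> g) ` ?K"
      then obtain f where f: "f \<in> F" "f \<otimes> inv g \<in> past (S g y)" "h = f \<otimes> inv g \<otimes> g" by auto
      then have "h = f" "f \<in> carrier G" using F g by (auto simp: m_assoc)
      then show "h \<in> {h \<in> F. (h, g) \<in> L y}"
        using f g equivariant[OF y, of "f \<otimes> inv g" \<one> g] by (auto simp: past_def m_assoc)
    next
      fix h assume h: "h \<in> {h \<in> F. (h, g) \<in> L y}"
      then have hc: "h \<in> carrier G" using F by auto
      then have "h = h \<otimes> inv g \<otimes> g" using g by (simp add: m_assoc)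
      moreover have "h \<otimes> inv g \<in> ?K"
        using h hc g equivariant[OF y, of "h \<otimes> inv g" \<one> g] by (auto simp: past_def m_assoc)
      ultimately show "h \<in> (\<lambda>u. u \<otimes> g) ` ?K" by (rule image_eqI)
    qed
    have "fcent (\<kappa> y) (\<lambda>x. cell P (T g x)) (itin {h \<in> F. (h, g) \<in> L y}) =
        fcent (\<kappa> y) (\<lambda>x. cell P (T g x)) (\<lambda>x. itin ?K (T g x))"
    proof (rule fcent_kernel[OF refl])
      fix x z assume "x \<in> space (\<kappa> y)" "z \<in> space (\<kappa> y)"
      then have xz: "x \<in> space M" "z \<in> space M" by (simp_all add: space_\<kappa>[OF y])
      have comp: "T (u \<otimes> g) w = T u (T g w)" if "u \<in> ?K" "w \<in> space M" for u w
        using that past_subset g by (intro T.composition_rule) auto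
      show "itin {h \<in> F. (h, g) \<in> L y} x = itin {h \<in> F. (h, g) \<in> L y} z \<longleftrightarrow>
          itin ?K (T g x) = itin ?K (T g z)"
        unfolding itin_eq_iff K[symmetric] Set.ball_simps(9)
        by (intro ball_cong refl) (simp only: comp xz)
    qed
    then show "fcent (\<kappa> y) (\<lambda>x. cell P (T g x)) (itin {h \<in> F. (h, g) \<in> L y}) =
        finite_rate (S g y) ?D"
      using eq by (simp add: finite_rate_def)
  qed
qed

text \<open>Invariance of \<open>N\<close> removes the shift \<open>S g\<close> that the translation
  to the unit introduced.\<close>

lemma integral_fent:
  assumes F: "finite F" "F \<subseteq> carrier G"
  shows "(\<integral>y. fent (\<kappa> y) (itin F) \<partial>N) =
    (\<Sum>g\<in>F. \<integral>y. finite_rate y ((\<lambda>h. h \<otimes> inv g) ` F) \<partial>N)"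
proof -
  have D: "finite ((\<lambda>h. h \<otimes> inv g) ` F)" "(\<lambda>h. h \<otimes> inv g) ` F \<subseteq> carrier G" if "g \<in> F" for g
    using F that by auto
  have meas: "(\<lambda>y. finite_rate (S g y) ((\<lambda>h. h \<otimes> inv g) ` F)) \<in> borel_measurable N" if "g \<in> F" for g
    using measurable_compose[OF measurable_S measurable_finite_rate[OF D[OF that]]] F that by auto
  have "AE y in N. \<forall>g\<in>F. fcent (\<kappa> y) (\<lambda>x. cell P (T g x)) (itin {h \<in> F. (h, g) \<in> L y}) =
      finite_rate (S g y) ((\<lambda>h. h \<otimes> inv g) ` F)"
    using F by (intro AE_finite_allI fcent_translate) auto
  then have "AE y in N. fent (\<kappa> y) (itin F) = (\<Sum>g\<in>F. finite_rate (S g y) ((\<lambda>h. h \<otimes> inv g) ` F))"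
    by (rule AE_mp) (intro AE_I2 impI, simp add: chain_rule F)
  then have "(\<integral>y. fent (\<kappa> y) (itin F) \<partial>N) =
      (\<integral>y. (\<Sum>g\<in>F. finite_rate (S g y) ((\<lambda>h. h \<otimes> inv g) ` F)) \<partial>N)"
    by (intro integral_cong_AE measurable_fent simple_itin F borel_measurable_sum meas)
  also have "\<dots> = (\<Sum>g\<in>F. \<integral>y. finite_rate (S g y) ((\<lambda>h. h \<otimes> inv g) ` F) \<partial>N)"
  proof (rule Bochner_Integration.integral_sum)
    fix g assume g: "g \<in> F"
    then have "S g y \<in> space N" if "y \<in> space N" for y using F that by (intro S_space) auto
    then show "integrable N (\<lambda>y. finite_rate (S g y) ((\<lambda>h. h \<otimes> inv g) ` F))"
      using finite_rate_bounds[OF _ D(1)[OF g]]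
      by (intro N.integrable_const_bound[of _ "real (card P)"] meas g) (auto intro!: AE_I2)
  qed
  also have "\<dots> = (\<Sum>g\<in>F. \<integral>y. finite_rate y ((\<lambda>h. h \<otimes> inv g) ` F) \<partial>N)"
  proof (rule sum.cong[OF refl])
    fix g assume g: "g \<in> F"
    then have gc: "g \<in> carrier G" using F by auto
    show "(\<integral>y. finite_rate (S g y) ((\<lambda>h. h \<otimes> inv g) ` F) \<partial>N) =
        (\<integral>y. finite_rate y ((\<lambda>h. h \<otimes> inv g) ` F) \<partial>N)"
      using integral_distr[OF measurable_S[OF gc] measurable_finite_rate[OF D[OF g]]]
      by (simp add: distr_S[OF gc])
  qed
  finally show ?thesis .
qed

section \<open>Mean fibre entropy and entropy given the factor\<close>

text \<open>The function \<open>\<lambda>x. measure (\<kappa> (\<phi> x)) v\<close> is a conditional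
  probability of \<open>v\<close> given the factor. The integral formula for conditional entropy
  applies, and a change of variables along \<open>\<phi>\<close> turns it into the mean of the fibre
  entropies.\<close>

lemma cond_part_entropy_pullback:
  assumes F: "finite F" "F \<subseteq> carrier G" "F \<noteq> {}"
  shows "cond_part_entropy M (join_partition M T P F) (pullback_sigma M N \<phi>) =
    (\<integral>y. fent (\<kappa> y) (itin F) \<partial>N)"
proof -
  let ?J = "join_partition M T P F" and ?B = "vimage_algebra (space M) \<phi> N"
  have \<phi>sp: "\<phi> \<in> space M \<rightarrow> space N" using measurable_space[OF measurable_\<phi>] by auto
  have setsB: "sets ?B = pullback_sigma M N \<phi>"
    unfolding pullback_sigma_def by (rule sets_vimage_algebra2[OF \<phi>sp])
  have B: "subalgebra M ?B"
    using measurable_sets[OF measurable_\<phi>] by (auto simp: subalgebra_def setsB pullback_sigma_def)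
  have J: "measurable_partition M (sets M) ?J"
    using F by (intro measurable_partition_join) auto
  then have JM: "A \<in> sets M" if "A \<in> ?J" for A
    using that by (auto simp: measurable_partition_def)
  have J': "partition_on (space M) ?J" and finJ: "finite ?J"
    using J by (auto simp: measurable_partition_def)
  have "cond_part_entropy M ?J (sets ?B) = (\<integral>x. (\<Sum>v\<in>?J. eta (measure (\<kappa> (\<phi> x)) v)) \<partial>M)"
  proof (rule M.cond_part_entropy_eq_integral[OF B J])
    show "(\<lambda>x. measure (\<kappa> (\<phi> x)) v) \<in> borel_measurable ?B" if "v \<in> ?J" for v
      by (rule measurable_compose[OF measurable_vimage_algebra1[OF \<phi>sp] measurable_measure_\<kappa>[OF JM[OF that]]])
    show "measure (\<kappa> (\<phi> x)) v \<in> {0..1}" if "v \<in> ?J" "x \<in> space M" for v x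
      using prob_space.prob_le_1[OF prob_space_\<kappa>[OF measurable_space[OF measurable_\<phi> that(2)]]] by simp
    show "(\<Sum>v\<in>?J. measure (\<kappa> (\<phi> x)) v) = 1" if x: "x \<in> space M" for x
    proof -
      have y: "\<phi> x \<in> space N" using measurable_space[OF measurable_\<phi> x] .
      interpret K: prob_space "\<kappa> (\<phi> x)" using y by (rule prob_space_\<kappa>)
      have "(\<Sum>v\<in>?J. measure (\<kappa> (\<phi> x)) v) = measure (\<kappa> (\<phi> x)) (\<Union>v\<in>?J. v)"
        using JM sets_\<kappa>[OF y] finJ disjointD[OF partition_onD2[OF J']]
        by (intro K.finite_measure_finite_Union[symmetric]) (fastforce simp: disjoint_family_on_def)+
      also have "(\<Union>v\<in>?J. v) = space (\<kappa> (\<phi> x))"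
        using partition_onD1[OF J'] space_\<kappa>[OF y] by simp
      finally show ?thesis by (simp add: K.prob_space)
    qed
    show "measure M (v \<inter> A) = (\<integral>x. indicator A x * measure (\<kappa> (\<phi> x)) v \<partial>M)"
      if v: "v \<in> ?J" and A: "A \<in> sets ?B" for v A
    proof -
      obtain C where C: "C \<in> sets N" "A = \<phi> -` C \<inter> space M"
        using A unfolding setsB pullback_sigma_def by auto
      have "v \<inter> A = v \<inter> \<phi> -` C" using C(2) sets.sets_into_space[OF JM[OF v]] by auto
      then have "ennreal (measure M (v \<inter> A)) = (\<integral>\<^sup>+y. emeasure (\<kappa> y) v * indicator C y \<partial>N)"
        using disintegration_Int[OF JM[OF v] C(1)] by (simp add: M.emeasure_eq_measure)
      also have "\<dots> = (\<integral>\<^sup>+y. ennreal (indicator C y * measure (\<kappa> y) v) \<partial>N)"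
      proof (rule nn_integral_cong)
        fix y assume "y \<in> space N"
        then interpret K: prob_space "\<kappa> y" by (rule prob_space_\<kappa>)
        show "emeasure (\<kappa> y) v * indicator C y = ennreal (indicator C y * measure (\<kappa> y) v)"
          by (simp add: K.emeasure_eq_measure indicator_def)
      qed
      also have "\<dots> = ennreal (\<integral>y. indicator C y * measure (\<kappa> y) v \<partial>N)"
      proof (rule nn_integral_eq_integral)
        have "(\<lambda>y. indicator C y * measure (\<kappa> y) v) \<in> borel_measurable N"
          using C(1) measurable_measure_\<kappa>[OF JM[OF v]] by measurable
        then show "integrable N (\<lambda>y. indicator C y * measure (\<kappa> y) v)"
          using prob_space.prob_le_1[OF prob_space_\<kappa>]
          by (intro N.integrable_const_bound[of _ 1]) (auto intro!: AE_I2 simp: indicator_def)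
      qed auto
      finally have "measure M (v \<inter> A) = (\<integral>y. indicator C y * measure (\<kappa> y) v \<partial>N)"
        by (subst (asm) ennreal_inj) (auto intro!: integral_nonneg_AE)
      also have "\<dots> = (\<integral>y. indicator C y * measure (\<kappa> y) v \<partial>distr M N \<phi>)"
        by (simp add: distr_\<phi>)
      also have "\<dots> = (\<integral>x. indicator C (\<phi> x) * measure (\<kappa> (\<phi> x)) v \<partial>M)"
        by (rule integral_distr) (use C(1) measurable_measure_\<kappa>[OF JM[OF v]] in measurable)
      also have "\<dots> = (\<integral>x. indicator A x * measure (\<kappa> (\<phi> x)) v \<partial>M)"
        by (intro Bochner_Integration.integral_cong) (auto simp: C(2) indicator_def)
      finally show ?thesis .
    qed
  qed
  also have "\<dots> = (\<integral>y. (\<Sum>v\<in>?J. eta (measure (\<kappa> y) v)) \<partial>distr M N \<phi>)"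
  proof (rule integral_distr[symmetric, OF measurable_\<phi>], rule borel_measurable_sum)
    fix v assume "v \<in> ?J"
    from measurable_measure_\<kappa>[OF JM[OF this]]
    show "(\<lambda>y. eta (measure (\<kappa> y) v)) \<in> borel_measurable N" unfolding eta_def by measurable
  qed
  also have "\<dots> = (\<integral>y. fent (\<kappa> y) (itin F) \<partial>N)"
    unfolding distr_\<phi>
  proof (rule Bochner_Integration.integral_cong[OF refl])
    fix y assume y: "y \<in> space N"
    have "(\<Sum>v\<in>?J. eta (measure (\<kappa> y) v)) = part_entropy (\<kappa> y) ?J"
      by (simp add: part_entropy_def eta_def sum_negf)
    also have "\<dots> = fent (\<kappa> y) (cell ?J)"
      using J' by (intro part_entropy_eq_fent) (simp add: space_\<kappa>[OF y])
    also have "\<dots> = fent (\<kappa> y) (itin F)"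
      by (intro fent_kernel) (use cell_join_eq_iff[OF F(2,3)] in \<open>simp add: space_\<kappa>[OF y]\<close>)
    finally show "(\<Sum>v\<in>?J. eta (measure (\<kappa> y) v)) = fent (\<kappa> y) (itin F)" .
  qed
  finally show ?thesis by (simp add: setsB)
qed

section \<open>The limit along a Folner sequence\<close>

text \<open>The limit is the same for every Folner sequence, as \<open>cond_dyn_entropy\<close>
  demands. The lower bound holds for each nonempty \<open>F n\<close>; in the upper one
  \<open>K\<close> is fixed while \<open>n\<close> grows and exhausts the group only
  afterwards.\<close>

theorem entropy_tendsto:
  assumes folner: "folner_seq G F"
  shows "(\<lambda>n. cond_part_entropy M (join_partition M T P (F n)) (pullback_sigma M N \<phi>) /
    real (card (F n))) \<longlonglongrightarrow> (\<integral>y. rate y \<partial>N)"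
proof -
  have F: "finite (F n)" "F n \<subseteq> carrier G" for n
    using folner by (auto simp: folner_seq_def)
  have lim: "(\<lambda>n. real (card (F n \<inter> (g <# F n))) / real (card (F n))) \<longlonglongrightarrow> 1"
    if "g \<in> carrier G" for g
    using folner that by (auto simp: folner_seq_def)
  \<comment> \<open>At the unit the quotient is 1 for nonempty \<open>F n\<close> and, by division
    by 0, equals 0 for empty \<open>F n\<close>; convergence to 1 thus excludes empty sets in the
    long run.\<close>
  have "\<forall>\<^sub>F n in sequentially. 0 < real (card (F n \<inter> (\<one> <# F n))) / real (card (F n))"
    using lim[OF one_closed] by (rule order_tendstoD) simp
  then have ne: "\<forall>\<^sub>F n in sequentially. F n \<noteq> {}"
    by eventually_elim auto
  define a where "a n = cond_part_entropy M (join_partition M T P (F n)) (pullback_sigma M N \<phi>) /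
    real (card (F n))" for n
  have a: "a n * real (card (F n)) = (\<Sum>g\<in>F n. \<integral>y. finite_rate y ((\<lambda>h. h \<otimes> inv g) ` F n) \<partial>N)"
    if "F n \<noteq> {}" for n
    using that F[of n]
    by (simp add: a_def cond_part_entropy_pullback integral_fent card_gt_0_iff)
  have D: "finite ((\<lambda>h. h \<otimes> inv g) ` F n)" "(\<lambda>h. h \<otimes> inv g) ` F n \<subseteq> carrier G"
    if "g \<in> F n" for g n
    using F[of n] that by auto
  have lower: "(\<integral>y. rate y \<partial>N) \<le> a n" if "F n \<noteq> {}" for n
  proof -
    have "real (card (F n)) * (\<integral>y. rate y \<partial>N) = (\<Sum>g\<in>F n. \<integral>y. rate y \<partial>N)" by simp
    also have "\<dots> \<le> a n * real (card (F n))"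
      unfolding a[OF that]
      by (intro sum_mono integral_mono integrable_rate integrable_finite_rate D rate_le)
    finally show ?thesis using that F(1)[of n] by (simp add: mult.commute card_gt_0_iff)
  qed
  \<comment> \<open>\<open>k \<otimes> g\<close> lies in \<open>F n\<close> exactly when
    \<open>g\<close> lies in \<open>inv k <# F n\<close>. So \<open>b K n\<close> adds up, over
    \<open>k\<close> in \<open>K\<close>, the proportion of elements of \<open>F n\<close> that
    \<open>k\<close> moves out of \<open>F n\<close>.\<close>
  define b where "b K n = (\<Sum>k\<in>K. 1 - real (card (F n \<inter> (inv k <# F n))) / real (card (F n)))"
    for K n
  have b0: "b K \<longlonglongrightarrow> 0" if "finite K" "K \<subseteq> carrier G" for K
  proof -
    have "(\<lambda>n. \<Sum>k\<in>K. 1 - real (card (F n \<inter> (inv k <# F n))) / real (card (F n))) \<longlonglongrightarrow> (\<Sum>k\<in>K. 1 - 1)"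
      using that by (intro tendsto_sum tendsto_diff tendsto_const lim) auto
    then show ?thesis unfolding b_def by simp
  qed
  have upper: "a n \<le> (\<integral>y. finite_rate y K \<partial>N) + real (card P) * b K n"
    if "F n \<noteq> {}" "finite K" "K \<subseteq> carrier G" for n K
  proof -
    define bad where "bad k = {g \<in> F n. k \<otimes> g \<notin> F n}" for k
    have pos: "real (card (F n)) > 0" using that(1) F(1)[of n] by (simp add: card_gt_0_iff)
    have bad: "real (card (bad k)) = (1 - real (card (F n \<inter> (inv k <# F n))) / real (card (F n))) * real (card (F n))"
      if k: "k \<in> K" for k
    proof -
      have kc: "k \<in> carrier G" using k \<open>K \<subseteq> carrier G\<close> by auto
      have "bad k = F n - (F n \<inter> (inv k <# F n))"
      proof -
        have "g \<in> inv k <# F n \<longleftrightarrow> k \<otimes> g \<in> F n" if "g \<in> F n" for g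
        proof
          assume "g \<in> inv k <# F n"
          then obtain f where f: "f \<in> F n" "g = inv k \<otimes> f" by (auto simp: l_coset_def)
          have "f \<in> carrier G" using f(1) F(2)[of n] by auto
          then have "k \<otimes> g = f" using kc by (simp add: f(2) m_assoc[symmetric])
          then show "k \<otimes> g \<in> F n" using f by simp
        next
          assume "k \<otimes> g \<in> F n"
          moreover have "g = inv k \<otimes> (k \<otimes> g)"
            using that F(2)[of n] kc by (simp add: m_assoc[symmetric] subset_iff)
          ultimately show "g \<in> inv k <# F n" by (auto simp: l_coset_def)
        qed
        then show ?thesis by (auto simp: bad_def)
      qed
      then have "real (card (bad k)) = real (card (F n)) - real (card (F n \<inter> (inv k <# F n)))"
        using F(1)[of n] by (simp add: card_Diff_subset of_nat_diff card_mono)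
      then show ?thesis using pos by (simp add: left_diff_distrib)
    qed
    \<comment> \<open>If some \<open>k\<close> moves \<open>g\<close> out of \<open>F n\<close>, the
      indicator sum is at least 1 and the trivial bound \<open>card P\<close> suffices. Otherwise
      \<open>K\<close> is contained in the right translate of \<open>F n\<close> by
      \<open>inv g\<close>, and conditioning on more only lowers the entropy.\<close>
    have one: "(\<integral>y. finite_rate y ((\<lambda>h. h \<otimes> inv g) ` F n) \<partial>N) \<le>
        (\<integral>y. finite_rate y K \<partial>N) + real (card P) * (\<Sum>k\<in>K. indicator (bad k) g)"
      if g: "g \<in> F n" for g
    proof (cases "\<exists>k\<in>K. g \<in> bad k")
      case True
      then obtain k where k: "k \<in> K" "g \<in> bad k" by blast
      have "(\<integral>y. finite_rate y ((\<lambda>h. h \<otimes> inv g) ` F n) \<partial>N) \<le> (\<integral>y. real (card P) \<partial>N)"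
        by (intro integral_mono integrable_finite_rate D g finite_rate_bounds) auto
      also have "\<dots> = real (card P)" by (simp add: N.prob_space)
      also have "\<dots> \<le> real (card P) * (\<Sum>k\<in>K. indicator (bad k) g)"
      proof -
        have "(1 :: real) = indicator (bad k) g" using k by simp
        also have "\<dots> \<le> (\<Sum>k\<in>K. indicator (bad k) g)"
          using k \<open>finite K\<close> by (intro member_le_sum) auto
        finally have "real (card P) * 1 \<le> real (card P) * (\<Sum>k\<in>K. indicator (bad k) g)"
          by (intro mult_left_mono) auto
        then show ?thesis by simp
      qed
      finally have "(\<integral>y. finite_rate y ((\<lambda>h. h \<otimes> inv g) ` F n) \<partial>N) \<le>
          real (card P) * (\<Sum>k\<in>K. indicator (bad k) g)" .
      moreover have "0 \<le> (\<integral>y. finite_rate y K \<partial>N)"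
        by (intro integral_nonneg_AE AE_I2 finite_rate_bounds \<open>finite K\<close>)
      ultimately show ?thesis by linarith
    next
      case False
      have gc: "g \<in> carrier G" using g F(2)[of n] by auto
      have "K \<subseteq> (\<lambda>h. h \<otimes> inv g) ` F n"
      proof
        fix k assume k: "k \<in> K"
        then have "k \<otimes> g \<in> F n" using False g by (auto simp: bad_def)
        moreover have "k = k \<otimes> g \<otimes> inv g" using k \<open>K \<subseteq> carrier G\<close> gc by (simp add: m_assoc subset_iff)
        ultimately show "k \<in> (\<lambda>h. h \<otimes> inv g) ` F n" by (intro image_eqI)
      qed
      then have "(\<integral>y. finite_rate y ((\<lambda>h. h \<otimes> inv g) ` F n) \<partial>N) \<le> (\<integral>y. finite_rate y K \<partial>N)"
        using that \<open>finite K\<close> \<open>K \<subseteq> carrier G\<close>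
        by (intro integral_mono integrable_finite_rate D g finite_rate_antimono)
      moreover have "0 \<le> real (card P) * (\<Sum>k\<in>K. indicator (bad k) g)"
        by (intro mult_nonneg_nonneg sum_nonneg) auto
      ultimately show ?thesis by linarith
    qed
    have "a n * real (card (F n)) \<le>
        (\<Sum>g\<in>F n. (\<integral>y. finite_rate y K \<partial>N) + real (card P) * (\<Sum>k\<in>K. indicator (bad k) g))"
      unfolding a[OF that(1)] by (intro sum_mono one)
    also have "\<dots> = real (card (F n)) * (\<integral>y. finite_rate y K \<partial>N) +
        real (card P) * (\<Sum>k\<in>K. \<Sum>g\<in>F n. indicator (bad k) g)"
      by (simp add: sum.distrib sum_distrib_left sum.swap[of _ K])
    also have "(\<Sum>k\<in>K. \<Sum>g\<in>F n. indicator (bad k) g) = (\<Sum>k\<in>K. real (card (bad k)))"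
    proof (rule sum.cong[OF refl])
      fix k
      have "F n \<inter> bad k = bad k" by (auto simp: bad_def)
      then show "(\<Sum>g\<in>F n. indicator (bad k) g) = real (card (bad k))"
        using F(1)[of n] by (simp add: indicator_def sum.If_cases)
    qed
    also have "\<dots> = b K n * real (card (F n))"
      unfolding b_def sum_distrib_right by (intro sum.cong refl bad)
    finally have "a n * real (card (F n)) \<le>
        ((\<integral>y. finite_rate y K \<partial>N) + real (card P) * b K n) * real (card (F n))"
      by (simp add: algebra_simps)
    then show ?thesis using pos by simp
  qed
  have "a \<longlonglongrightarrow> (\<integral>y. rate y \<partial>N)"
  proof (rule order_tendstoI)
    fix c assume c: "c < (\<integral>y. rate y \<partial>N)"
    from ne show "\<forall>\<^sub>F n in sequentially. c < a n"
      by eventually_elim (use lower c in force)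
  next
    fix c assume "(\<integral>y. rate y \<partial>N) < c"
    then have "\<forall>\<^sub>F m in sequentially. (\<integral>y. finite_rate y (exhaust m) \<partial>N) < c"
      by (rule order_tendstoD[OF integral_finite_rate_tendsto])
    then obtain m where m: "(\<integral>y. finite_rate y (exhaust m) \<partial>N) < c"
      by (auto simp: eventually_sequentially)
    have "(\<lambda>n. (\<integral>y. finite_rate y (exhaust m) \<partial>N) + real (card P) * b (exhaust m) n) \<longlonglongrightarrow>
        (\<integral>y. finite_rate y (exhaust m) \<partial>N) + real (card P) * 0"
      by (intro tendsto_intros b0 exhaust)
    then have "\<forall>\<^sub>F n in sequentially.
        (\<integral>y. finite_rate y (exhaust m) \<partial>N) + real (card P) * b (exhaust m) n < c"
      by (rule order_tendstoD) (use m in simp)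
    with ne show "\<forall>\<^sub>F n in sequentially. a n < c"
      by eventually_elim (rule le_less_trans[OF upper[OF _ exhaust]])
  qed
  then show ?thesis unfolding a_def .
qed

end

section \<open>Orders of type \<open>\<int>\<close>\<close>

lemma strict_linear_order_on_converse:
  "strict_linear_order_on A r \<Longrightarrow> strict_linear_order_on A (r\<inverse>)"
  by (simp add: strict_linear_order_on_def)

lemma is_successor_converse: "is_successor G (r\<inverse>) a b \<longleftrightarrow> is_successor G r b a"
  by (auto simp: is_successor_def)

text \<open>Reversing the order produces the negative half of the enumeration from the construction
  of the positive half.\<close>

lemma Z_orders_converse:
  assumes "r \<in> Z_orders G"
  shows "r\<inverse> \<in> Z_orders G"
proof -
  have "order_interval G (r\<inverse>) a b = order_interval G r b a" for a b
    by (auto simp: order_interval_def)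
  then show ?thesis
    using assms strict_linear_order_on_converse by (fastforce simp: Z_orders_def)
qed

context
  fixes G :: "('g, 'm) monoid_scheme" and r :: "'g rel"
  assumes r: "r \<in> Z_orders G"
begin

lemma Z_order_carrier: "(a, b) \<in> r \<Longrightarrow> a \<in> carrier G \<and> b \<in> carrier G"
  using r by (auto simp: Z_orders_def)

lemma Z_order_trans: "(a, b) \<in> r \<Longrightarrow> (b, c) \<in> r \<Longrightarrow> (a, c) \<in> r"
  using r by (auto simp: Z_orders_def strict_linear_order_on_def dest: transD)

lemma Z_order_irrefl: "(a, a) \<notin> r"
  using r by (auto simp: Z_orders_def strict_linear_order_on_def irrefl_def)

lemma Z_order_total: "a \<in> carrier G \<Longrightarrow> b \<in> carrier G \<Longrightarrow> (a, b) \<in> r \<or> a = b \<or> (b, a) \<in> r"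
  using r by (auto simp: Z_orders_def strict_linear_order_on_def total_on_def)

lemma Z_order_finite: "(a, b) \<in> r \<Longrightarrow> finite (order_interval G r a b)"
  using r by (auto simp: Z_orders_def)

lemma is_successor_carrier: "is_successor G r a b \<Longrightarrow> a \<in> carrier G \<and> b \<in> carrier G"
  using Z_order_carrier by (auto simp: is_successor_def)

text \<open>Above \<open>a\<close> and up to some larger \<open>b\<close> there are finitely many
  elements; the successor is the least of them, found as the greatest for the converse
  order.\<close>

lemma successor_exists:
  assumes a: "a \<in> carrier G"
  obtains b where "is_successor G r a b"
proof -
  obtain b where b: "b \<in> carrier G" "(a, b) \<in> r" using a r by (auto simp: Z_orders_def)
  define U where "U = {g \<in> carrier G. (a, g) \<in> r \<and> (g = b \<or> (g, b) \<in> r)}"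
  have "U \<subseteq> order_interval G r a b" by (auto simp: U_def order_interval_def)
  then have "finite U" using Z_order_finite[OF b(2)] by (rule finite_subset)
  moreover have "strict_linear_order_on (carrier G) (r\<inverse>)"
    using r by (intro strict_linear_order_on_converse) (simp add: Z_orders_def)
  moreover have "U \<subseteq> carrier G" "U \<noteq> {}" using b by (auto simp: U_def)
  ultimately obtain m where m: "m \<in> U" "\<And>h. h \<in> U \<Longrightarrow> h \<noteq> m \<Longrightarrow> (h, m) \<in> r\<inverse>"
    using strict_linear_order_max by metis
  have "\<not> ((a, c) \<in> r \<and> (c, m) \<in> r)" if c: "c \<in> carrier G" for c
  proof
    assume *: "(a, c) \<in> r \<and> (c, m) \<in> r"
    then have "c \<in> U" using m(1) c Z_order_trans by (auto simp: U_def)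
    then have "c = m \<or> (m, c) \<in> r" using m(2) by auto
    then show False using * Z_order_irrefl Z_order_trans by blast
  qed
  then have "is_successor G r a m" using m(1) by (auto simp: is_successor_def U_def)
  then show thesis by (rule that)
qed

lemma successor_unique:
  assumes "is_successor G r a b" "is_successor G r a b'"
  shows "b = b'"
  using assms is_successor_carrier[OF assms(1)] is_successor_carrier[OF assms(2)] Z_order_total[of b b']
  unfolding is_successor_def by blast

lemma predecessor_unique:
  assumes "is_successor G r b a" "is_successor G r b' a"
  shows "b = b'"
  using assms is_successor_carrier[OF assms(1)] is_successor_carrier[OF assms(2)] Z_order_total[of b b']
  unfolding is_successor_def by blast

text \<open>An element above the unit that is missed by iterating the successor would stay above all
  iterates and so put infinitely many of them into one finite interval.\<close>

lemma successor_sequence: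
  assumes G: "group G"
  obtains f :: "nat \<Rightarrow> 'g" where "f 0 = \<one>\<^bsub>G\<^esub>" "\<And>n. is_successor G r (f n) (f (Suc n))"
    "\<And>g. (\<one>\<^bsub>G\<^esub>, g) \<in> r \<Longrightarrow> g \<in> range f"
proof -
  interpret group G by (rule G)
  define s where "s a = (SOME b. is_successor G r a b)" for a
  have s: "is_successor G r a (s a)" if a: "a \<in> carrier G" for a
  proof -
    obtain b where "is_successor G r a b" using successor_exists[OF a] .
    then show ?thesis unfolding s_def by (rule someI)
  qed
  define f where "f n = (s ^^ n) \<one>\<^bsub>G\<^esub>" for n :: nat
  have f0: "f 0 = \<one>\<^bsub>G\<^esub>" and fSuc: "f (Suc n) = s (f n)" for n by (simp_all add: f_def)
  have fc: "f n \<in> carrier G" for n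
    by (induction n) (auto simp: f0 fSuc dest: s is_successor_carrier)
  have fs: "is_successor G r (f n) (f (Suc n))" for n unfolding fSuc using fc by (rule s)
  have mono: "(f m, f n) \<in> r" if "m < n" for m n
    using that
  proof (induction n)
    case (Suc n)
    have "(f n, f (Suc n)) \<in> r" using fs[of n] by (simp add: is_successor_def)
    then show ?case using Suc Z_order_trans by (cases "m = n") auto
  qed simp
  have "g \<in> range f" if g: "(\<one>\<^bsub>G\<^esub>, g) \<in> r" for g
  proof (rule ccontr)
    assume ng: "g \<notin> range f"
    have gc: "g \<in> carrier G" using Z_order_carrier[OF g] by simp
    have lt: "(f n, g) \<in> r" for n
    proof (induction n)
      case (Suc n)
      then have "(g, f (Suc n)) \<notin> r" using fs[of n] gc by (auto simp: is_successor_def)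
      then show ?case using Z_order_total[OF gc fc[of "Suc n"]] ng by auto
    qed (simp add: f0 g)
    have "range f \<subseteq> order_interval G r \<one>\<^bsub>G\<^esub> g"
    proof
      fix z assume "z \<in> range f"
      then obtain n where z: "z = f n" by auto
      show "z \<in> order_interval G r \<one>\<^bsub>G\<^esub> g"
        using mono[of 0 n] lt[of n] fc[of n] by (cases "n = 0") (auto simp: z f0 order_interval_def)
    qed
    then have "finite (range f)" using Z_order_finite[OF g] by (rule finite_subset)
    moreover have "inj f"
    proof (rule injI)
      fix m n assume "f m = f n"
      then show "m = n" using mono[of m n] mono[of n m] Z_order_irrefl by (metis linorder_neqE_nat)
    qed
    ultimately show False using finite_imageD by blast
  qed
  with f0 fs show thesis by (rule that)
qed

lemma successor_mono:
  fixes f :: "int \<Rightarrow> 'g"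
  assumes "\<And>i. is_successor G r (f i) (f (i + 1))" "i < j"
  shows "(f i, f j) \<in> r"
  using assms(2)
proof (induction j rule: int_gr_induct)
  case base
  then show ?case using assms(1)[of i] by (simp add: is_successor_def)
next
  case (step j)
  then show ?case using assms(1)[of j] Z_order_trans by (auto simp: is_successor_def)
qed

end

text \<open>This gives the definite description in \<open>order_enum\<close> its meaning. Two
  successor sequences, along the order and along its converse, are glued at the unit; uniqueness is
  induction from 0 in both directions.\<close>

lemma order_enum_ex1:
  fixes G :: "('g, 'm) monoid_scheme"
  assumes G: "group G" and r: "r \<in> Z_orders G"
  shows "\<exists>!f :: int \<Rightarrow> 'g. bij_betw f UNIV (carrier G) \<and> f 0 = \<one>\<^bsub>G\<^esub> \<and> (\<forall>i. is_successor G r (f i) (f (i + 1)))"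
proof -
  interpret group G by (rule G)
  obtain p where p: "p 0 = \<one>\<^bsub>G\<^esub>" "\<And>n. is_successor G r (p n) (p (Suc n))"
    "\<And>g. (\<one>\<^bsub>G\<^esub>, g) \<in> r \<Longrightarrow> g \<in> range p"
    using successor_sequence[OF r G] by metis
  obtain q where q: "q 0 = \<one>\<^bsub>G\<^esub>" "\<And>n. is_successor G r (q (Suc n)) (q n)"
    "\<And>g. (g, \<one>\<^bsub>G\<^esub>) \<in> r \<Longrightarrow> g \<in> range q"
    using successor_sequence[OF Z_orders_converse[OF r] G]
    unfolding is_successor_converse converse_iff by metis
  define f where "f i = (if i \<ge> 0 then p (nat i) else q (nat (- i)))" for i :: int
  have fs: "is_successor G r (f i) (f (i + 1))" for i
  proof (cases "i \<ge> 0")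
    case True
    then have "nat (i + 1) = Suc (nat i)" by simp
    then show ?thesis using p(2)[of "nat i"] True by (simp add: f_def)
  next
    case False
    then have *: "nat (- i) = Suc (nat (- (i + 1)))" by simp
    \<comment> \<open>For \<open>i = -1\<close> the index \<open>i + 1\<close> falls into the other
      branch; both sequences start at the unit, so the formula persists.\<close>
    have "f (i + 1) = q (nat (- (i + 1)))" using False p(1) q(1) by (auto simp: f_def)
    then show ?thesis using q(2)[of "nat (- (i + 1))"] False by (simp only: f_def * if_False)
  qed
  have f0: "f 0 = \<one>\<^bsub>G\<^esub>" using p(1) by (simp add: f_def)
  have bij: "bij_betw f UNIV (carrier G)"
    unfolding bij_betw_def
  proof (intro conjI equalityI subsetI)
    show "inj f"
    proof (rule injI)
      fix i j assume "f i = f j"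
      then show "i = j"
        using successor_mono[OF r, where f = f and i = i and j = j, OF fs]
          successor_mono[OF r, where f = f and i = j and j = i, OF fs] Z_order_irrefl[OF r]
        by (metis linorder_neqE_linordered_idom)
    qed
    show "g \<in> carrier G" if "g \<in> range f" for g
      using that is_successor_carrier[OF r fs] by auto
    show "g \<in> range f" if g: "g \<in> carrier G" for g
    proof -
      consider "g = \<one>\<^bsub>G\<^esub>" | "(\<one>\<^bsub>G\<^esub>, g) \<in> r" | "(g, \<one>\<^bsub>G\<^esub>) \<in> r"
        using Z_order_total[OF r g one_closed] by blast
      then show ?thesis
      proof cases
        case 1
        then show ?thesis using f0 by (metis rangeI)
      next
        case 2
        then obtain n where "g = p n" using p(3) by blast
        then have "g = f (int n)" by (simp add: f_def)
        then show ?thesis by simp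
      next
        case 3
        then obtain n where "g = q n" using q(3) by blast
        then have "g = f (- int n)" using p(1) q(1) by (cases "n = 0") (auto simp: f_def)
        then show ?thesis by simp
      qed
    qed
  qed
  have uniq: "f' = f" if f': "f' 0 = \<one>\<^bsub>G\<^esub>" "\<forall>i. is_successor G r (f' i) (f' (i + 1))" for f'
  proof
    fix i :: int
    show "f' i = f i"
    proof (induction i rule: int_induct[of _ 0])
      case base
      show ?case using f' f0 by simp
    next
      case (step1 i)
      then show ?case using successor_unique[OF r f'(2)[rule_format, of i]] fs[of i] by simp
    next
      case (step2 i)
      then show ?case
        using predecessor_unique[OF r, of "f' (i - 1)" "f i" "f (i - 1)"] f'(2)[rule_format, of "i - 1"]
          fs[of "i - 1"] by simp
    qed
  qed
  show ?thesis
    by (rule ex1I[of _ f]) (use bij f0 fs uniq in blast)+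
qed

text \<open>The enumeration is strictly increasing and sends 0 to the unit, so negative and positive
  indices give the elements below and above the unit: the sets \<open>past\<close> for the order and
  for its converse.\<close>

lemma
  assumes G: "group G" and r: "r \<in> Z_orders G"
  shows order_enum_past: "order_enum G r ` {i. i \<le> -1} = {h \<in> carrier G. (h, \<one>\<^bsub>G\<^esub>) \<in> r}"
    and order_enum_future: "order_enum G r ` {i. i \<ge> 1} = {h \<in> carrier G. (\<one>\<^bsub>G\<^esub>, h) \<in> r}"
proof -
  define f where "f = order_enum G r"
  have f: "bij_betw f UNIV (carrier G)" "f 0 = \<one>\<^bsub>G\<^esub>" "\<And>i. is_successor G r (f i) (f (i + 1))"
    using theI'[OF order_enum_ex1[OF G r]] unfolding f_def order_enum_def by blast+
  have mono: "(f i, f j) \<in> r \<longleftrightarrow> i < j" for i j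
    using successor_mono[OF r, where f = f and i = i and j = j, OF f(3)]
      successor_mono[OF r, where f = f and i = j and j = i, OF f(3)]
      Z_order_irrefl[OF r, of "f i"] Z_order_trans[OF r, of "f i" "f j" "f i"]
    by (cases i j rule: linorder_cases) auto
  have range: "carrier G = range f" using f(1) by (simp add: bij_betw_def)
  have "f ` {i. i < 0} = {h \<in> range f. (h, f 0) \<in> r}" "f ` {i. 0 < i} = {h \<in> range f. (f 0, h) \<in> r}"
    using mono by blast+
  moreover have "{i. i \<le> -1} = {i :: int. i < 0}" "{i. i \<ge> 1} = {i :: int. 0 < i}"
    by auto
  ultimately show "f ` {i. i \<le> -1} = {h \<in> carrier G. (h, \<one>\<^bsub>G\<^esub>) \<in> r}"
    and "f ` {i. i \<ge> 1} = {h \<in> carrier G. (\<one>\<^bsub>G\<^esub>, h) \<in> r}"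
    by (simp_all only: range f(2))
qed

section \<open>Borel structure on the set of orders\<close>

lemma topspace_Z_orders: "topspace (Z_orders_topology G) = Z_orders G"
  by (auto simp: Z_orders_topology_def topspace_pullback_topology)

text \<open>Evaluation at the pair is a coordinate projection to a discrete space, and the set is
  the preimage of \<open>True\<close>.\<close>

lemma openin_Z_orders:
  assumes "a \<in> carrier G" "b \<in> carrier G"
  shows "openin (Z_orders_topology G) {r \<in> Z_orders G. (a, b) \<in> r}"
proof -
  let ?X = "product_topology (\<lambda>_. discrete_topology (UNIV :: bool set)) (carrier G \<times> carrier G)"
  have "continuous_map ?X (discrete_topology UNIV) (\<lambda>x. x (a, b))"
    using assms by (intro continuous_map_product_projection) simp
  then have "openin ?X {x \<in> topspace ?X. x (a, b) \<in> {True}}"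
    by (rule openin_continuous_map_preimage) simp
  then show ?thesis
    unfolding Z_orders_topology_def openin_pullback_topology
    by (rule_tac exI, rule_tac conjI, assumption) (use assms in auto)
qed

lemma
  assumes "sets \<nu> = sets (borel_of (Z_orders_topology G))"
  shows space_Z_orders: "space \<nu> = Z_orders G"
    and sets_Z_orders: "a \<in> carrier G \<Longrightarrow> b \<in> carrier G \<Longrightarrow> {r \<in> space \<nu>. (a, b) \<in> r} \<in> sets \<nu>"
proof -
  have sub: "{U. openin (Z_orders_topology G) U} \<subseteq> Pow (topspace (Z_orders_topology G))"
    using openin_subset by blast
  show sp: "space \<nu> = Z_orders G"
    using sets_eq_imp_space_eq[OF assms] space_measure_of[OF sub]
    by (simp add: borel_of_def topspace_Z_orders)
  show "{r \<in> space \<nu>. (a, b) \<in> r} \<in> sets \<nu>" if "a \<in> carrier G" "b \<in> carrier G"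
    using openin_Z_orders[OF that] sets_measure_of[OF sub]
    by (simp add: assms sp borel_of_def)
qed

lemma order_action_iff:
  assumes "r \<in> Z_orders G" "a \<in> carrier G" "b \<in> carrier G"
  shows "(a, b) \<in> order_action G g r \<longleftrightarrow> (a \<otimes>\<^bsub>G\<^esub> g, b \<otimes>\<^bsub>G\<^esub> g) \<in> r"
  using assms by (simp add: order_action_def)

theorem theorem4p5:
  fixes G :: "('g, 'm) monoid_scheme"
    and M :: "'x measure"
    and T :: "'g \<Rightarrow> 'x \<Rightarrow> 'x"
    and \<nu> :: "'g rel measure"
    and \<phi> :: "'x \<Rightarrow> 'g rel"
    and \<kappa> :: "'g rel \<Rightarrow> 'x measure"
    and P :: "'x set set"
  assumes "countable_amenable_group G"
    and "standard_prob_space M"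
    and "mp_action G M T"
    and "multiorder G \<nu>"
    and "factor_map G M T \<nu> (order_action G) \<phi>"
    and "measurable_partition M (sets M) P"
    and "disintegration M \<nu> \<phi> \<kappa>"
  shows "integrable \<nu> (\<lambda>r. cond_part_entropy (\<kappa> r) P (past_sigma G M T P r)) \<and>
    integrable \<nu> (\<lambda>r. cond_part_entropy (\<kappa> r) P (future_sigma G M T P r)) \<and>
    cond_dyn_entropy G M T P (pullback_sigma M \<nu> \<phi>) =
      (\<integral>r. cond_part_entropy (\<kappa> r) P (past_sigma G M T P r) \<partial>\<nu>) \<and>
    cond_dyn_entropy G M T P (pullback_sigma M \<nu> \<phi>) =
      (\<integral>r. cond_part_entropy (\<kappa> r) P (future_sigma G M T P r) \<partial>\<nu>)"
proof -
  have G: "group G" and cG: "countable (carrier G)" and folner: "\<exists>F. folner_seq G F"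
    using assms(1) by (auto simp: countable_amenable_group_def)
  have sets: "sets \<nu> = sets (borel_of (Z_orders_topology G))" and mp: "mp_action G \<nu> (order_action G)"
    using assms(4) by (auto simp: multiorder_def)
  note space = space_Z_orders[OF sets] and meas = sets_Z_orders[OF sets]
  have linear: "strict_linear_order_on (carrier G) r" if "r \<in> space \<nu>" for r
    using that unfolding space by (simp add: Z_orders_def)
  have act: "(order_action G g) r \<in> Z_orders G" if "r \<in> Z_orders G" "g \<in> carrier G" for g r
    using that mp measurable_space[of "order_action G g" \<nu> \<nu> r] unfolding mp_action_def space by auto
  interpret past: ordered_factor G M T \<nu> "order_action G" \<phi> \<kappa> P "\<lambda>r. r"
    by (intro ordered_factor.intro ordered_factor_axioms.intro G cG assms mp linear meas)
      (auto simp: space order_action_iff)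
  interpret future: ordered_factor G M T \<nu> "order_action G" \<phi> \<kappa> P "\<lambda>r. r\<inverse>"
    by (intro ordered_factor.intro ordered_factor_axioms.intro G cG assms mp
        strict_linear_order_on_converse linear)
      (auto simp: space order_action_iff meas[unfolded space])
  have past: "cond_part_entropy (\<kappa> r) P (past_sigma G M T P r) = past.rate r" if "r \<in> space \<nu>" for r
    using that unfolding space past.rate_def past.past_def past_sigma_def
    by (simp add: order_enum_past[OF G])
  have future: "cond_part_entropy (\<kappa> r) P (future_sigma G M T P r) = future.rate r"
    if "r \<in> space \<nu>" for r
    using that unfolding space future.rate_def future.past_def future_sigma_def
    by (simp add: order_enum_future[OF G])
  \<comment> \<open>Some Folner sequence exists, and along it two candidate values would both be
    limits; hence the definite description is determined.\<close>
  have dyn: "cond_dyn_entropy G M T P (pullback_sigma M \<nu> \<phi>) = h"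
    if "\<And>F. folner_seq G F \<Longrightarrow> (\<lambda>n. cond_part_entropy M (join_partition M T P (F n))
      (pullback_sigma M \<nu> \<phi>) / real (card (F n))) \<longlonglongrightarrow> h" for h
    unfolding cond_dyn_entropy_def
  proof (rule the_equality)
    obtain F where F: "folner_seq G F" using folner ..
    fix h' assume "\<forall>F. folner_seq G F \<longrightarrow> (\<lambda>n. cond_part_entropy M (join_partition M T P (F n))
      (pullback_sigma M \<nu> \<phi>) / real (card (F n))) \<longlonglongrightarrow> h'"
    with F have "(\<lambda>n. cond_part_entropy M (join_partition M T P (F n))
      (pullback_sigma M \<nu> \<phi>) / real (card (F n))) \<longlonglongrightarrow> h'" by blast
    then show "h' = h" using that[OF F] by (rule LIMSEQ_unique)
  qed (use that in blast)
  have "(\<integral>r. cond_part_entropy (\<kappa> r) P (past_sigma G M T P r) \<partial>\<nu>) = (\<integral>r. past.rate r \<partial>\<nu>)"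
    by (rule Bochner_Integration.integral_cong[OF refl past])
  moreover have "(\<integral>r. cond_part_entropy (\<kappa> r) P (future_sigma G M T P r) \<partial>\<nu>) = (\<integral>r. future.rate r \<partial>\<nu>)"
    by (rule Bochner_Integration.integral_cong[OF refl future])
  moreover have "integrable \<nu> (\<lambda>r. cond_part_entropy (\<kappa> r) P (past_sigma G M T P r))"
    using past.integrable_rate by (subst Bochner_Integration.integrable_cong[OF refl past])
  moreover have "integrable \<nu> (\<lambda>r. cond_part_entropy (\<kappa> r) P (future_sigma G M T P r))"
    using future.integrable_rate by (subst Bochner_Integration.integrable_cong[OF refl future])
  ultimately show ?thesis
    using dyn[OF past.entropy_tendsto] dyn[OF future.entropy_tendsto] by simp
qed

end
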